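(* Let $G=(V,E,\mu,w)$ be a weighted forest with $n$ vertices. Then for every $k\in\{1,\dots,n\}$, $$\lambda_k^{\gamma}(\Delta_1)=\lambda_k^{\gamma^+}(\Delta_1)=\lambda_k^{\textrm{Y-ind}}(\Delta_1),$$ where $\gamma$ is the Krasnoselskii genus, $\gamma^+$ the Conner-Floyd index and $\textrm{Y-ind}$ the Yang index.
   Context: A weighted graph is a quadruple $G=(V,E,\mu,w)$ with finite vertex set $V=\{1,\dots,n\}$, edge set $E\subseteq\{\{u,v\}:u\neq v\text{ in }V\}$, vertex weight $\mu:V\to(0,\infty)$ and edge weight $w:E\to(0,\infty)$; write $\mu_v=\mu(v)$, $w_{uv}=w(\{u,v\})$. A weighted forest is a weighted graph whose underlying graph has no cycles (it need not be connected). For $x\in\mathbb R^n\setminus\{0\}$ let $\Phi_1(x)=\dfrac{\sum_{\{u,v\}\in E}w_{uv}|x_u-x_v|}{\sum_{v\in V}\mu_v|x_v|}$. For $\mathrm{ind}\in\{\gamma,\gamma^+,\textrm{Y-ind}\}$ define $\lambda_k^{\mathrm{ind}}(\Delta_1)=\inf_S\max_{x\in S}\Phi_1(x)$, the infimum over all nonempty compact $S\subset\mathbb R^n\setminus\{0\}$ with $S=-S$ and $\mathrm{ind}(S)\ge k$. For such $S$: - $\gamma(S)=\min\{k\in\mathbb Z^+:\text{there is an odd continuous map }S\to\mathbb R^k\setminus\{0\}\}$. - $\gamma^+(S)=\max\{k\in\mathbb Z^+:\text{there is an odd continuous map }\mathbb S^{k-1}\to S\}$, where $\mathbb S^{k-1}$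 is the unit sphere of $\mathbb R^k$. - Yang index: let $T(x)=-x$ on $S$ and $T_\#$ the induced map on the singular chain complex $C_*(S;\mathbb Z_2)$. Let $C_q(S,T)=\{c\in C_q(S;\mathbb Z_2):T_\#c=c\}$ be the subcomplex of symmetric chains (equivalently, chains of the form $c'+T_\#c'$), with cycles $Z_q(S,T)$, boundaries $B_q(S,T)$ and homology $H_q(S,T)$. Define homomorphisms $\nu:Z_q(S,T)\to\mathbb Z_2$ inductively: if $z=c+T_\#c$, then $\nu(z)=\mathrm{In}(c)$ for $q=0$, where $\mathrm{In}(\sum_i n_i\sigma_i)=\sum_i n_i$, and $\nu(z)=\nu(\partial c)$ for $q>0$. This is well defined, vanishes on $B_q(S,T)$, and induces $\nu_*:H_q(S,T)\to\mathbb Z_2$. Then $\textrm{Y-ind}(S)=\min\{k\ge0:\nu_*(H_k(S,T))=0\}$ (normalized so that $\textrm{Y-ind}(\mathbb S^{k-1})=k$). *)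

theory Defs
  imports "HOL-Homology.Homology" "HOL-Library.Z2" "HOL-Library.Extended_Nat"
begin

section \<open>Weighted graphs and forests\<close>

text \<open>The vertex set is the finite index type \<open>'n\<close>, so \<open>n = CARD('n)\<close> and \<open>real ^ 'n\<close> is the
  space of vertex functions.\<close>

locale weighted_graph =
  fixes E :: "'n::finite set set" and \<mu> :: "'n \<Rightarrow> real" and w :: "'n set \<Rightarrow> real"
  assumes edges: "E \<subseteq> {{u, v} | u v. u \<noteq> v}"
    and vertex_weight_pos: "\<mu> v > 0"
    and edge_weight_pos: "e \<in> E \<Longrightarrow> w e > 0"

definition graph_cycle :: "'n set set \<Rightarrow> 'n list \<Rightarrow> bool" where
  "graph_cycle E vs \<longleftrightarrow> length vs \<ge> 3 \<and> distinct vs \<and>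
     (\<forall>i < length vs. {vs ! i, vs ! (Suc i mod length vs)} \<in> E)"

locale weighted_forest = weighted_graph +
  assumes no_cycle: "\<nexists>vs. graph_cycle E vs"

text \<open>The sum over ordered pairs counts each edge twice, hence the factor \<open>1 / 2\<close>.\<close>

definition total_variation :: "'n::finite set set \<Rightarrow> ('n set \<Rightarrow> real) \<Rightarrow> real ^ 'n \<Rightarrow> real" where
  "total_variation E w x =
     (\<Sum>(u, v) \<in> {(u, v). {u, v} \<in> E}. w {u, v} * \<bar>x $ u - x $ v\<bar>) / 2"

definition Phi1 ::
  "'n::finite set set \<Rightarrow> ('n \<Rightarrow> real) \<Rightarrow> ('n set \<Rightarrow> real) \<Rightarrow> real ^ 'n \<Rightarrow> real" where
  "Phi1 E \<mu> w x = total_variation E w x / (\<Sum>v\<in>UNIV. \<mu> v * \<bar>x $ v\<bar>)"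


section \<open>Krasnoselskii genus and Conner--Floyd index\<close>

text \<open>All indices take values in \<open>enat\<close>, where a minimum (maximum) over a set of naturals is the
  infimum (supremum). \<open>Euclidean_space k\<close> and \<open>nsphere (k - 1)\<close> are the library's copies of
  \<open>\<real>\<^sup>k\<close> and of its unit sphere inside \<open>nat \<Rightarrow> real\<close>.\<close>

definition genus :: "'a::real_normed_vector set \<Rightarrow> enat" where
  "genus S = (INF k \<in> {k. k \<ge> 1 \<and>
     (\<exists>f. continuous_map (top_of_set S) (subtopology (Euclidean_space k) (- {\<lambda>i. 0})) f \<and>
          (\<forall>x\<in>S. f (- x) = (\<lambda>i. - f x i)))}. enat k)"

definition conner_floyd_index :: "'a::real_normed_vector set \<Rightarrow> enat" where
  "conner_floyd_index S = (SUP k \<in> {k. k \<ge> 1 \<and>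
     (\<exists>g. continuous_map (nsphere (k - 1)) (top_of_set S) g \<and>
          (\<forall>x\<in>topspace (nsphere (k - 1)). g (\<lambda>i. - x i) = - g x))}. enat k)"


section \<open>Yang index\<close>

text \<open>The library's singular chains have integer coefficients; the following are their analogues
  with coefficients in the two-element field \<open>bit\<close>, so the boundary carries no signs.\<close>

type_synonym 'a chain2 = "((nat \<Rightarrow> real) \<Rightarrow> 'a) \<Rightarrow>\<^sub>0 bit"

definition chains2 :: "nat \<Rightarrow> 'a topology \<Rightarrow> 'a chain2 set" where
  "chains2 q X = {c. Poly_Mapping.keys c \<subseteq> singular_simplex_set q X}"

definition boundary2 :: "nat \<Rightarrow> 'a chain2 \<Rightarrow> 'a chain2" where
  "boundary2 q c = (if q = 0 then 0 else
     (\<Sum>\<sigma> \<in> Poly_Mapping.keys c. \<Sum>i\<le>q.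
        Poly_Mapping.single (singular_face q i \<sigma>) (Poly_Mapping.lookup c \<sigma>)))"

definition chain_map2 :: "nat \<Rightarrow> ('a \<Rightarrow> 'b) \<Rightarrow> 'a chain2 \<Rightarrow> 'b chain2" where
  "chain_map2 q f c = (\<Sum>\<sigma> \<in> Poly_Mapping.keys c.
     Poly_Mapping.single (simplex_map q f \<sigma>) (Poly_Mapping.lookup c \<sigma>))"

definition chain_index2 :: "'a chain2 \<Rightarrow> bit" where
  "chain_index2 c = (\<Sum>\<sigma> \<in> Poly_Mapping.keys c. Poly_Mapping.lookup c \<sigma>)"

definition sym_chains :: "nat \<Rightarrow> 'a topology \<Rightarrow> ('a \<Rightarrow> 'a) \<Rightarrow> 'a chain2 set" where
  "sym_chains q X T = {c \<in> chains2 q X. chain_map2 q T c = c}"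

definition sym_cycles :: "nat \<Rightarrow> 'a topology \<Rightarrow> ('a \<Rightarrow> 'a) \<Rightarrow> 'a chain2 set" where
  "sym_cycles q X T = {z \<in> sym_chains q X T. boundary2 q z = 0}"

definition sym_boundaries :: "nat \<Rightarrow> 'a topology \<Rightarrow> ('a \<Rightarrow> 'a) \<Rightarrow> 'a chain2 set" where
  "sym_boundaries q X T = boundary2 (Suc q) ` sym_chains (Suc q) X T"

definition sym_homology :: "nat \<Rightarrow> 'a topology \<Rightarrow> ('a \<Rightarrow> 'a) \<Rightarrow> 'a chain2 set set" where
  "sym_homology q X T = sym_cycles q X T //
     {(z, z'). z \<in> sym_cycles q X T \<and> z' \<in> sym_cycles q X T \<and> z - z' \<in> sym_boundaries q X T}"

text \<open>For a fixed-point-free involution \<open>T\<close> every symmetric chain has the form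
  \<open>c + chain_map2 q T c\<close>, and the value of \<open>yang_nu\<close> on a symmetric cycle does not depend on the
  choice of \<open>c\<close>.\<close>

definition half_chain :: "nat \<Rightarrow> 'a topology \<Rightarrow> ('a \<Rightarrow> 'a) \<Rightarrow> 'a chain2 \<Rightarrow> 'a chain2" where
  "half_chain q X T z = (SOME c. c \<in> chains2 q X \<and> z = c + chain_map2 q T c)"

fun yang_nu :: "nat \<Rightarrow> 'a topology \<Rightarrow> ('a \<Rightarrow> 'a) \<Rightarrow> 'a chain2 \<Rightarrow> bit" where
  "yang_nu 0 X T z = chain_index2 (half_chain 0 X T z)"
| "yang_nu (Suc q) X T z = yang_nu q X T (boundary2 (Suc q) (half_chain (Suc q) X T z))"

text \<open>\<open>yang_nu\<close> vanishes on symmetric boundaries, so it is constant on each homology class.\<close>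

definition yang_nu_star :: "nat \<Rightarrow> 'a topology \<Rightarrow> ('a \<Rightarrow> 'a) \<Rightarrow> 'a chain2 set \<Rightarrow> bit" where
  "yang_nu_star q X T h = the_elem (yang_nu q X T ` h)"

definition yang_index :: "'a::real_normed_vector set \<Rightarrow> enat" where
  "yang_index S = (INF k \<in> {k. yang_nu_star k (top_of_set S) uminus `
     sym_homology k (top_of_set S) uminus = {0}}. enat k)"


section \<open>Min-max eigenvalues\<close>

text \<open>For continuous \<open>\<Phi>\<close> the inner supremum, over a nonempty compact set, is a maximum.\<close>

definition minmax_eigenvalue ::
  "('a::real_normed_vector set \<Rightarrow> enat) \<Rightarrow> ('a \<Rightarrow> real) \<Rightarrow> nat \<Rightarrow> real" where
  "minmax_eigenvalue ind \<Phi> k =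
     (INF S \<in> {S. S \<noteq> {} \<and> compact S \<and> 0 \<notin> S \<and> uminus ` S = S \<and> enat k \<le> ind S}.
        SUP x\<in>S. \<Phi> x)"

end

theory Submission
  imports Defs "HOL-Analysis.Cartesian_Euclidean_Space"
begin

text \<open>
Write \<open>Q(h)\<close> for the assertion that there are \<open>k\<close> disjoint nonempty vertex sets \<open>A\<close>, each with
boundary weight at most \<open>h\<close> times its vertex weight. Each of the three eigenvalues is the infimum of
the \<open>h\<close> that satisfy \<open>Q(h)\<close>, the \<open>k\<close>-way Cheeger constant of the forest. All that matters about
the index is that it lies between the Conner--Floyd index and the genus.

If \<open>Q(h)\<close> holds, the odd map \<open>t \<mapsto> \<Sum>i. t i \<cdot> 1\<^bsub>A i\<^esub>\<close> carries the sphere of dimension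
\<open>k - 1\<close> into \<open>{\<Phi>\<^sub>1 \<le> h}\<close>, because the total variation is a seminorm and the vertex norm is additive over
disjoint supports (\<open>packing_admissible\<close>). This image has Conner--Floyd index at least \<open>k\<close>.

Conversely, suppose that \<open>Q(h)\<close> fails. The minimal vertex sets with Cheeger ratio at most \<open>h\<close>
induce subtrees of the forest, and for subtrees of a forest the largest packing is as
large as the smallest transversal (\<open>packing_transversal\<close>). So fewer than \<open>k\<close> vertices \<open>P\<close> meet
every set of ratio at most \<open>h\<close>. By the layer-cake decomposition of the total variation, a nonzero
vector that vanishes on \<open>P\<close> has \<open>\<Phi>\<^sub>1 > h\<close> (\<open>total_variation_gt\<close>). Restriction to \<open>P\<close>
is therefore an odd map from \<open>{\<Phi>\<^sub>1 \<le> h}\<close> to a punctured space of dimension less than \<open>k\<close>, and no symmetric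
nonempty subset of \<open>{\<Phi>\<^sub>1 \<le> h}\<close> has genus \<open>k\<close> or more (\<open>admissible_packing\<close>).

It remains to see that the Yang index lies between the Conner--Floyd index and the genus. Choose one
point of every orbit of the involution and call a \<open>q\<close>-simplex alternating if its vertices are
alternately not chosen and chosen, beginning with one that is not. Yang's \<open>\<nu>\<close> counts the alternating
simplices of a symmetric cycle modulo two (\<open>yang_nu_eq_alternation_number\<close>); this is evaluation
of a power of the characteristic class of the double covering of the orbit space. Every
octahedral cycle has exactly one alternating simplex (\<open>octahedral_cycle\<close>), which gives the lower
bound. On a space that is covered by the sets \<open>{f i \<noteq> 0}\<close> of \<open>m\<close> odd functions, the class
vanishes on every set of the cover, so its \<open>m\<close>-th power vanishes; \<open>alternation_vanishes\<close> is this cup length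
argument on the level of chains. It gives the upper bound.
\<close>

section \<open>Singular chains modulo two\<close>

lemma bit_chain_add_self [simp]: "c + c = (0 :: 'k \<Rightarrow>\<^sub>0 bit)"
  by (rule poly_mapping_eqI) (simp add: lookup_add)

lemma bit_chain_uminus [simp]: "- c = (c :: 'k \<Rightarrow>\<^sub>0 bit)"
  by (rule poly_mapping_eqI) simp

lemma bit_chain_add_cancel [simp]: "a + (a + b) = (b :: 'k \<Rightarrow>\<^sub>0 bit)"
  by (simp flip: add.assoc)

lemma bit_chain_add_eq_0_iff: "a + b = 0 \<longleftrightarrow> a = (b :: 'k \<Rightarrow>\<^sub>0 bit)"
  by (metis bit_chain_add_cancel bit_chain_add_self add.right_neutral)

text \<open>A chain over the two-element field is the same as the finite set of its simplices, and the sum of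
two chains is their symmetric difference. Equations between chains are checked in this form.\<close>

lemma lookup_bit_chain: "Poly_Mapping.lookup c k = of_bool (k \<in> Poly_Mapping.keys c)" for c :: "'k \<Rightarrow>\<^sub>0 bit"
  by (auto simp: in_keys_iff)

lemma bit_chain_eqI: "Poly_Mapping.keys a = Poly_Mapping.keys b \<Longrightarrow> a = b" for a b :: "'k \<Rightarrow>\<^sub>0 bit"
  by (rule poly_mapping_eqI) (simp add: lookup_bit_chain)

lemma keys_bit_chain_add: "k \<in> Poly_Mapping.keys (a + b) \<longleftrightarrow> (k \<in> Poly_Mapping.keys a) \<noteq> (k \<in> Poly_Mapping.keys b)" for a b :: "'k \<Rightarrow>\<^sub>0 bit"
  by (auto simp: in_keys_iff lookup_add simp del: add_bit_eq_xor) 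

definition chain_of_set :: "'k set \<Rightarrow> 'k \<Rightarrow>\<^sub>0 bit" where
  "chain_of_set K = (\<Sum>k\<in>K. Poly_Mapping.single k 1)"

lemma keys_chain_of_set [simp]: "finite K \<Longrightarrow> Poly_Mapping.keys (chain_of_set K) = K"
proof (induction K rule: finite_induct)
  case (insert k K)
  have "chain_of_set (insert k K) = Poly_Mapping.single k 1 + chain_of_set K"
    using insert.hyps by (simp add: chain_of_set_def)
  moreover have "Poly_Mapping.keys (Poly_Mapping.single k (1::bit)) = {k}"
    by simp
  moreover have "k \<notin> Poly_Mapping.keys (chain_of_set K)"
    using insert by (simp only: not_False_eq_True)
  ultimately show ?case
    unfolding set_eq_iff by (simp only: keys_bit_chain_add insert.IH) blast
qed (simp add: chain_of_set_def)

lemma chain_of_set_keys: "chain_of_set (Poly_Mapping.keys c) = c"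
  by (rule bit_chain_eqI) simp

lemma bit_chain_induct [consumes 1, case_names zero single add]:
  fixes c :: "'k \<Rightarrow>\<^sub>0 bit"
  assumes "Poly_Mapping.keys c \<subseteq> S" "P 0" "\<And>k. k \<in> S \<Longrightarrow> P (Poly_Mapping.single k 1)"
    "\<And>a b. Poly_Mapping.keys a \<subseteq> S \<Longrightarrow> Poly_Mapping.keys b \<subseteq> S \<Longrightarrow> P a \<Longrightarrow> P b \<Longrightarrow> P (a + b)"
  shows "P c"
proof -
  have "P (chain_of_set K)" if "finite K" "K \<subseteq> S" for K
    using that
  proof (induction K rule: finite_induct)
    case (insert k K)
    moreover have "chain_of_set (insert k K) = Poly_Mapping.single k 1 + chain_of_set K"
      using insert.hyps by (simp add: chain_of_set_def)
    ultimately show ?case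
      using assms(3,4) by auto
  qed (simp add: chain_of_set_def assms(2))
  from this[of "Poly_Mapping.keys c"] show ?thesis
    using assms(1) by (simp add: chain_of_set_keys)
qed

text \<open>Every linear operator on chains below is a sum over the support. Such a sum is additive because
a simplex that occurs in both chains cancels and contributes \<open>g k + g k = 0\<close>.\<close>

lemma sum_keys_bit_chain_add:
  fixes a b :: "'k \<Rightarrow>\<^sub>0 bit" and g :: "'k \<Rightarrow> 'b::comm_monoid_add"
  assumes "\<And>k. g k + g k = 0"
  shows "sum g (Poly_Mapping.keys (a + b)) = sum g (Poly_Mapping.keys a) + sum g (Poly_Mapping.keys b)"
proof -
  define f where "f k x = (if x = (1::bit) then g k else 0)" for k x
  have *: "sum g (Poly_Mapping.keys c) = (\<Sum>k\<in>Poly_Mapping.keys c. f k (Poly_Mapping.lookup c k))" for c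
    by (rule sum.cong) (auto simp: f_def in_keys_iff)
  have add: "f k (x + y) = f k x + f k y" for k x y
    by (cases x; cases y) (simp_all add: f_def assms)
  show ?thesis
    unfolding * by (rule setsum_keys_plus_distrib) (simp add: f_def, rule add)
qed

lemma boundary2_Suc:
  "boundary2 (Suc q) c = (\<Sum>\<sigma>\<in>Poly_Mapping.keys c. \<Sum>i\<le>Suc q. Poly_Mapping.single (singular_face (Suc q) i \<sigma>) 1)"
  unfolding boundary2_def by (simp add: lookup_bit_chain del: sum.atMost_Suc)

lemma chain_map2_eq: "chain_map2 q f c = (\<Sum>\<sigma>\<in>Poly_Mapping.keys c. Poly_Mapping.single (simplex_map q f \<sigma>) 1)"
  unfolding chain_map2_def by (simp add: lookup_bit_chain)

lemma boundary2_0 [simp]: "boundary2 q 0 = 0" "boundary2 0 c = 0"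
  by (auto simp: boundary2_def)

lemma chain_map2_0 [simp]: "chain_map2 q f 0 = 0"
  by (simp add: chain_map2_def)

lemma boundary2_add: "boundary2 q (a + b) = boundary2 q a + boundary2 q b"
  by (cases q) (simp_all only: boundary2_0 boundary2_Suc sum_keys_bit_chain_add bit_chain_add_self add_0)

lemma chain_map2_add: "chain_map2 q f (a + b) = chain_map2 q f a + chain_map2 q f b"
  unfolding chain_map2_eq by (rule sum_keys_bit_chain_add) simp

lemma boundary2_single:
  "boundary2 (Suc q) (Poly_Mapping.single \<sigma> 1) = (\<Sum>i\<le>Suc q. Poly_Mapping.single (singular_face (Suc q) i \<sigma>) 1)"
  unfolding boundary2_Suc by (simp del: sum.atMost_Suc)

lemma chain_map2_single [simp]:
  "chain_map2 q f (Poly_Mapping.single \<sigma> 1) = Poly_Mapping.single (simplex_map q f \<sigma>) 1"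
  unfolding chain_map2_eq by simp

lemma chains2_0 [simp]: "0 \<in> chains2 q X"
  by (simp add: chains2_def)

lemma chains2_add: "a \<in> chains2 q X \<Longrightarrow> b \<in> chains2 q X \<Longrightarrow> a + b \<in> chains2 q X"
  by (auto simp: chains2_def keys_bit_chain_add subset_iff)

lemma chains2_sum: "(\<And>i. i \<in> I \<Longrightarrow> c i \<in> chains2 q X) \<Longrightarrow> sum c I \<in> chains2 q X"
  by (induction I rule: infinite_finite_induct) (auto intro: chains2_add)

lemma chains2_single: "singular_simplex q X \<sigma> \<Longrightarrow> Poly_Mapping.single \<sigma> 1 \<in> chains2 q X"
  by (simp add: chains2_def)

lemma boundary2_in_chains2: "c \<in> chains2 (Suc q) X \<Longrightarrow> boundary2 (Suc q) c \<in> chains2 q X"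
  unfolding boundary2_Suc chains2_def[of "Suc q"]
  by (intro chains2_sum chains2_single)
     (use singular_simplex_singular_face[where p="Suc q"] in auto)

lemma chain_map2_in_chains2:
  "c \<in> chains2 q X \<Longrightarrow> continuous_map X Y f \<Longrightarrow> chain_map2 q f c \<in> chains2 q Y"
  unfolding chain_map2_eq chains2_def[of _ X]
  by (intro chains2_sum chains2_single singular_simplex_simplex_map) auto

definition mod2 :: "('k \<Rightarrow>\<^sub>0 int) \<Rightarrow> 'k \<Rightarrow>\<^sub>0 bit" where
  "mod2 c = Poly_Mapping.map of_int c"

lemma lookup_mod2: "Poly_Mapping.lookup (mod2 c) k = of_int (Poly_Mapping.lookup c k)"
  unfolding mod2_def by (simp add: map.rep_eq when_def)

lemma mod2_zero [simp]: "mod2 0 = 0"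
  by (rule poly_mapping_eqI) (simp add: lookup_mod2)

lemma mod2_frag_of [simp]: "mod2 (frag_of k) = Poly_Mapping.single k 1"
  by (rule poly_mapping_eqI) (auto simp add: lookup_mod2 lookup_single when_def)

lemma mod2_add: "mod2 (a + b) = mod2 a + mod2 b"
  by (rule poly_mapping_eqI) (simp add: lookup_mod2 lookup_add del: add_bit_eq_xor)

lemma mod2_uminus [simp]: "mod2 (- a) = mod2 a"
  by (rule poly_mapping_eqI) (simp add: lookup_mod2)

lemma mod2_diff: "mod2 (a - b) = mod2 a + mod2 b"
  using mod2_add[of a "- b"] by simp

lemma mod2_sum: "mod2 (sum f I) = (\<Sum>i\<in>I. mod2 (f i))"
  by (induction I rule: infinite_finite_induct) (auto simp: mod2_add)

lemma mod2_sign [simp]: "mod2 (frag_cmul ((- 1) ^ n) c) = mod2 c"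
  by (cases "even n") auto

lemma keys_mod2: "Poly_Mapping.keys (mod2 c) \<subseteq> Poly_Mapping.keys c"
  by (auto simp: in_keys_iff lookup_mod2)

lemma mod2_in_chains2: "singular_chain q X c \<Longrightarrow> mod2 c \<in> chains2 q X"
  using keys_mod2[of c] by (auto simp: chains2_def singular_chain_def)

text \<open>Reduction modulo two commutes with the boundary, with induced maps and with subdivision. A
lift to an integral chain therefore transfers the integral identities to coefficients in \<open>bit\<close>.\<close>

lemma chains2_lift:
  assumes "c \<in> chains2 q X"
  obtains d where "singular_chain q X d" "mod2 d = c"
proof -
  have "Poly_Mapping.keys c \<subseteq> singular_simplex_set q X"
    using assms by (simp add: chains2_def)
  then have "\<exists>d. singular_chain q X d \<and> mod2 d = c"
  proof (induction c rule: bit_chain_induct)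
    case zero
    show ?case by (rule exI[of _ 0]) simp
  next
    case (single \<sigma>)
    then show ?case by (intro exI[of _ "frag_of \<sigma>"]) (simp add: singular_chain_of)
  next
    case (add a b)
    then obtain d e where "singular_chain q X d" "mod2 d = a" "singular_chain q X e" "mod2 e = b"
      by blast
    then show ?case
      by (intro exI[of _ "d + e"]) (simp only: singular_chain_add mod2_add simp_thms)
  qed
  then show thesis using that by blast
qed

lemma mod2_chain_boundary: "mod2 (chain_boundary q c) = boundary2 q (mod2 c)"
  using subset_UNIV
proof (induction c rule: frag_induction)
  case (one \<sigma>)
  then show ?case
    by (cases q) (simp_all add: chain_boundary_of chain_boundary_def[of 0] mod2_sum boundary2_single del: sum.atMost_Suc)
qed (simp_all add: chain_boundary_diff mod2_diff boundary2_add)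

lemma mod2_chain_map: "mod2 (chain_map q f c) = chain_map2 q f (mod2 c)"
  using subset_UNIV
  by (induction c rule: frag_induction) (simp_all add: chain_map_diff mod2_diff chain_map2_add)

lemma boundary2_boundary2:
  assumes "c \<in> chains2 (Suc q) X"
  shows "boundary2 q (boundary2 (Suc q) c) = 0"
proof -
  obtain d where d: "singular_chain (Suc q) X d" and c: "c = mod2 d"
    using chains2_lift assms by metis
  show ?thesis
    using chain_boundary_boundary[OF d] by (simp add: c flip: mod2_chain_boundary)
qed

lemma boundary2_chain_map2:
  assumes "c \<in> chains2 (Suc q) X"
  shows "boundary2 (Suc q) (chain_map2 (Suc q) f c) = chain_map2 q f (boundary2 (Suc q) c)"
proof -
  obtain d where d: "singular_chain (Suc q) X d" and c: "c = mod2 d"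
    using chains2_lift assms by metis
  show ?thesis
    using chain_boundary_chain_map[OF d, of f] by (simp add: c flip: mod2_chain_boundary mod2_chain_map)
qed

definition subdivision2 :: "nat \<Rightarrow> 'a chain2 \<Rightarrow> 'a chain2" where
  "subdivision2 q c = (\<Sum>\<sigma>\<in>Poly_Mapping.keys c. mod2 (singular_subdivision q (frag_of \<sigma>)))"

lemma subdivision2_add: "subdivision2 q (a + b) = subdivision2 q a + subdivision2 q b"
  unfolding subdivision2_def by (rule sum_keys_bit_chain_add) simp

lemma mod2_singular_subdivision: "mod2 (singular_subdivision q c) = subdivision2 q (mod2 c)"
  using subset_UNIV
  by (induction c rule: frag_induction)
     (simp_all add: singular_subdivision_diff mod2_diff subdivision2_add, simp_all add: subdivision2_def)

lemma subdivision2_in_chains2: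
  assumes "c \<in> chains2 q X"
  shows "subdivision2 q c \<in> chains2 q X"
proof -
  obtain d where d: "singular_chain q X d" and c: "c = mod2 d"
    using chains2_lift assms by metis
  show ?thesis
    using singular_chain_singular_subdivision[OF d]
    by (simp add: c mod2_in_chains2 flip: mod2_singular_subdivision)
qed

lemma subdivision2_zero_dim:
  assumes "c \<in> chains2 0 X"
  shows "subdivision2 0 c = c"
proof -
  obtain d where d: "singular_chain 0 X d" and c: "c = mod2 d"
    using chains2_lift assms by metis
  show ?thesis
    using singular_subdivision_zero[OF d] by (simp add: c flip: mod2_singular_subdivision)
qed

lemma boundary2_subdivision2:
  assumes "c \<in> chains2 (Suc q) X"
  shows "boundary2 (Suc q) (subdivision2 (Suc q) c) = subdivision2 q (boundary2 (Suc q) c)"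
proof -
  obtain d where d: "singular_chain (Suc q) X d" and c: "c = mod2 d"
    using chains2_lift assms by metis
  show ?thesis
    using chain_boundary_singular_subdivision[OF d]
    by (simp add: c flip: mod2_singular_subdivision mod2_chain_boundary)
qed

lemma subdivision2_chain_map2:
  assumes "c \<in> chains2 q X"
  shows "subdivision2 q (chain_map2 q f c) = chain_map2 q f (subdivision2 q c)"
proof -
  obtain d where d: "singular_chain q X d" and c: "c = mod2 d"
    using chains2_lift assms by metis
  show ?thesis
    using naturality_singular_subdivision[OF d, of f]
    by (simp add: c flip: mod2_singular_subdivision mod2_chain_map)
qed

lemma iterated_subdivision2_small:
  assumes "\<And>U. U \<in> \<C> \<Longrightarrow> openin X U" "topspace X \<subseteq> \<Union>\<C>" "c \<in> chains2 q X"
  obtains n where "\<And>\<sigma>. \<sigma> \<in> Poly_Mapping.keys ((subdivision2 q ^^ n) c) \<Longrightarrow> \<exists>U\<in>\<C>. \<sigma> ` standard_simplex q \<subseteq> U"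
proof -
  obtain d where d: "singular_chain q X d" "c = mod2 d"
    using chains2_lift[OF assms(3)] by metis
  obtain n where n: "\<And>m \<sigma>. n \<le> m \<Longrightarrow> \<sigma> \<in> Poly_Mapping.keys ((singular_subdivision q ^^ m) d) \<Longrightarrow> \<exists>U\<in>\<C>. \<sigma> \<in> standard_simplex q \<rightarrow> U"
    using sufficient_iterated_singular_subdivision_exists[OF assms(1,2) d(1)] by blast
  have eq: "(subdivision2 q ^^ m) c = mod2 ((singular_subdivision q ^^ m) d)" for m
    by (induction m) (simp_all add: d mod2_singular_subdivision)
  show thesis
  proof (rule that)
    fix \<sigma> assume "\<sigma> \<in> Poly_Mapping.keys ((subdivision2 q ^^ n) c)"
    then have "\<sigma> \<in> Poly_Mapping.keys ((singular_subdivision q ^^ n) d)"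
      unfolding eq using keys_mod2 by (rule rev_subsetD)
    then show "\<exists>U\<in>\<C>. \<sigma> ` standard_simplex q \<subseteq> U"
      using n[OF order_refl] by (simp add: image_subset_iff_funcset)
  qed
qed

section \<open>Alternating simplices of a free involution\<close>

abbreviation vertex :: "nat \<Rightarrow> nat \<Rightarrow> real" where
  "vertex i \<equiv> (\<lambda>j. if j = i then 1 else 0)"

text \<open>The choice operator is applied to the same set \<open>{x, T x}\<close> at both points of an orbit and so
selects one of them. The selection need not be continuous, and it does not refer to a space, so it is
compatible with passing to invariant subspaces.\<close>

definition side :: "('a \<Rightarrow> 'a) \<Rightarrow> 'a \<Rightarrow> bool" where
  "side T x \<longleftrightarrow> x = (SOME y. y = x \<or> y = T x)"

definition alternating :: "('a \<Rightarrow> 'a) \<Rightarrow> nat \<Rightarrow> ((nat \<Rightarrow> real) \<Rightarrow> 'a) \<Rightarrow> bool" where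
  "alternating T q \<sigma> \<longleftrightarrow> (\<forall>i\<le>q. side T (\<sigma> (vertex i)) = odd i)"

definition alternation_number :: "('a \<Rightarrow> 'a) \<Rightarrow> nat \<Rightarrow> 'a chain2 \<Rightarrow> bit" where
  "alternation_number T q c = (\<Sum>\<sigma>\<in>Poly_Mapping.keys c. of_bool (alternating T q \<sigma>))"

lemma bit_add_self [simp]: "x + x = (0::bit)"
  by (cases x) simp_all

lemma alternation_number_add:
  "alternation_number T q (a + b) = alternation_number T q a + alternation_number T q b"
  unfolding alternation_number_def by (rule sum_keys_bit_chain_add) (rule bit_add_self)

lemma alternation_number_0 [simp]: "alternation_number T q 0 = 0"
  by (simp add: alternation_number_def)

lemma alternation_number_single [simp]:
  "alternation_number T q (Poly_Mapping.single \<sigma> 1) = of_bool (alternating T q \<sigma>)"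
  by (simp add: alternation_number_def)

lemma alternation_number_sum:
  "alternation_number T q (sum c I) = (\<Sum>i\<in>I. alternation_number T q (c i))"
  by (induction I rule: infinite_finite_induct) (simp_all add: alternation_number_add del: add_bit_eq_xor)

text \<open>Counts modulo two the positions whose deletion turns the sequence \<open>f\<close> into the alternating sequence
that begins with \<open>b\<close>. From an alternating sequence, deleting an inner entry creates a repetition,
and exactly one of the two ends can be deleted to obtain the prescribed beginning. A sequence that is not
alternating contributes only if it has a single repetition; then either of the two equal entries can be
deleted, and the count is even. The induction separates the deletion of the first entry from all others.\<close>

lemma alternating_deletions:
  fixes f :: "nat \<Rightarrow> bool"
  shows "(\<Sum>k\<le>Suc n. of_bool (\<forall>i\<le>n. f (if i < k then i else Suc i) = (b \<noteq> odd i)) :: bit) =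
    of_bool (\<forall>i\<le>Suc n. f i = odd i) + of_bool (\<forall>i\<le>Suc n. f i = even i)"
proof (induction n arbitrary: f b)
  case 0
  have [simp]: "(\<forall>i\<le>Suc 0. P i) \<longleftrightarrow> P 0 \<and> P 1" for P
    using le_Suc_eq by auto
  show ?case
    by (cases "f 0"; cases "f 1"; cases b) simp_all
next
  case (Suc n)
  let ?g = "\<lambda>i. f (Suc i)"
  have all_Suc: "(\<forall>i\<le>Suc m. P i) \<longleftrightarrow> P 0 \<and> (\<forall>i\<le>m. P (Suc i))" for P :: "nat \<Rightarrow> bool" and m
    by (metis Suc_le_mono le0 not0_implies_Suc)
  let ?D = "\<lambda>k. \<forall>i\<le>Suc n. f (if i < k then i else Suc i) = (b \<noteq> odd i)"
  let ?D' = "\<lambda>k. \<forall>i\<le>n. ?g (if i < k then i else Suc i) = ((\<not> b) \<noteq> odd i)"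
  have D_Suc: "?D (Suc k) \<longleftrightarrow> f 0 = b \<and> ?D' k" for k
    unfolding all_Suc by (simp add: if_distrib[of f] if_distrib[of "\<lambda>i. f (Suc i)"] cong: if_cong)
  have "(\<Sum>k\<le>Suc (Suc n). of_bool (?D k) :: bit) = of_bool (?D 0) + (\<Sum>k\<le>Suc n. of_bool (?D (Suc k)))"
    by (rule sum.atMost_Suc_shift)
  also have "(\<Sum>k\<le>Suc n. of_bool (?D (Suc k)) :: bit) = (if f 0 = b then \<Sum>k\<le>Suc n. of_bool (?D' k) else 0)"
    unfolding D_Suc by simp
  also have "(\<Sum>k\<le>Suc n. of_bool (?D' k) :: bit) =
    of_bool (\<forall>i\<le>Suc n. ?g i = odd i) + of_bool (\<forall>i\<le>Suc n. ?g i = even i)"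
    by (rule Suc.IH)
  finally have sum: "(\<Sum>k\<le>Suc (Suc n). of_bool (?D k) :: bit) = of_bool (?D 0) +
    (if f 0 = b then of_bool (\<forall>i\<le>Suc n. ?g i = odd i) + of_bool (\<forall>i\<le>Suc n. ?g i = even i) else 0)" .
  have odd: "(\<forall>i\<le>Suc (Suc n). f i = odd i) \<longleftrightarrow> \<not> f 0 \<and> (\<forall>i\<le>Suc n. ?g i = even i)"
    by (subst all_Suc) simp
  have even: "(\<forall>i\<le>Suc (Suc n). f i = even i) \<longleftrightarrow> f 0 \<and> (\<forall>i\<le>Suc n. ?g i = odd i)"
    by (subst all_Suc) simp
  have D0: "?D 0 \<longleftrightarrow> (if b then \<forall>i\<le>Suc n. ?g i = even i else \<forall>i\<le>Suc n. ?g i = odd i)"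
    by simp
  have "of_bool (if b then Q else P) + (if f 0 = b then of_bool P + of_bool Q else 0) =
      (of_bool (\<not> f 0 \<and> Q) + of_bool (f 0 \<and> P) :: bit)" for P Q
    by (cases "f 0"; cases b; cases P; cases Q) simp_all
  then show ?case
    unfolding sum odd even D0 .
qed

lemma simplical_face_vertex: "simplical_face k (vertex i) = vertex (if i < k then i else Suc i)"
  by (rule ext) (auto simp: simplical_face_def)

lemma singular_face_vertex:
  "i \<le> q \<Longrightarrow> singular_face (Suc q) k \<sigma> (vertex i) = \<sigma> (vertex (if i < k then i else Suc i))"
  by (simp only: singular_face_def diff_Suc_Suc minus_nat.diff_0 restrict_apply basis_in_standard_simplex
      simp_thms if_True o_apply simplical_face_vertex)

locale free_involution =
  fixes X :: "'a topology" and T :: "'a \<Rightarrow> 'a"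
  assumes continuous_involution: "continuous_map X X T"
    and involution: "x \<in> topspace X \<Longrightarrow> T (T x) = x"
    and fixpoint_free: "x \<in> topspace X \<Longrightarrow> T x \<noteq> x"
begin

lemma involution_in_topspace: "x \<in> topspace X \<Longrightarrow> T x \<in> topspace X"
  using continuous_involution by (auto simp: continuous_map_def)

lemma side_involution:
  assumes "x \<in> topspace X"
  shows "side T (T x) \<longleftrightarrow> \<not> side T x"
proof -
  define r where "r = (SOME y. y = x \<or> y = T x)"
  have "r = x \<or> r = T x"
    unfolding r_def by (rule someI[of _ x]) simp
  moreover have "side T x \<longleftrightarrow> x = r"
    by (simp add: side_def r_def)
  moreover have "side T (T x) \<longleftrightarrow> T x = r"
    using involution[OF assms] by (simp add: side_def r_def disj_commute)
  ultimately show ?thesis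
    using fixpoint_free[OF assms] by metis
qed

lemma free_involution_subtopology:
  assumes "T ` U \<subseteq> U"
  shows "free_involution (subtopology X U) T"
proof
  show "continuous_map (subtopology X U) (subtopology X U) T"
    using continuous_involution assms
    by (auto simp: continuous_map_in_subtopology continuous_map_from_subtopology)
qed (auto simp: involution fixpoint_free)

lemma vertex_in_topspace:
  "singular_simplex q X \<sigma> \<Longrightarrow> i \<le> q \<Longrightarrow> \<sigma> (vertex i) \<in> topspace X"
  by (auto simp: singular_simplex_def continuous_map_def)

lemma simplex_map_involution:
  assumes "singular_simplex q X \<sigma>"
  shows "simplex_map q T (simplex_map q T \<sigma>) = \<sigma>"
proof -
  have "simplex_map q (T \<circ> T) \<sigma> = \<sigma>"
    using assms by (rule simplex_map_id_gen) (simp add: involution)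
  then show ?thesis
    by (simp add: simplex_map_compose)
qed

lemma chain_map2_involution_in_chains2: "c \<in> chains2 q X \<Longrightarrow> chain_map2 q T c \<in> chains2 q X"
  using continuous_involution by (rule chain_map2_in_chains2[rotated])

lemma keys_chain_map2_involution:
  assumes "c \<in> chains2 q X"
  shows "Poly_Mapping.keys (chain_map2 q T c) = simplex_map q T ` Poly_Mapping.keys c"
proof -
  have "inj_on (simplex_map q T) (Poly_Mapping.keys c)"
    using assms by (intro inj_on_inverseI[of _ "simplex_map q T"] simplex_map_involution) (auto simp: chains2_def)
  then have "chain_map2 q T c = chain_of_set (simplex_map q T ` Poly_Mapping.keys c)"
    unfolding chain_map2_eq chain_of_set_def by (simp add: sum.reindex o_def)
  then show ?thesis
    by simp
qed

text \<open>A set that contains exactly one simplex of every orbit is one half of the symmetric chain.\<close>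

lemma sym_chain_split:
  assumes z: "z \<in> sym_chains q X T"
    and K: "Poly_Mapping.keys z = K \<union> simplex_map q T ` K" "K \<inter> simplex_map q T ` K = {}"
  shows "chain_of_set K \<in> chains2 q X" "z = chain_of_set K + chain_map2 q T (chain_of_set K)"
proof -
  have "finite (Poly_Mapping.keys z)"
    by simp
  then have fin: "finite K"
    unfolding K by simp
  moreover have "K \<subseteq> Poly_Mapping.keys z"
    unfolding K by simp
  ultimately show c: "chain_of_set K \<in> chains2 q X"
    using z by (auto simp: sym_chains_def chains2_def)
  show "z = chain_of_set K + chain_map2 q T (chain_of_set K)"
    using K(2) by (intro bit_chain_eqI set_eqI)
      (auto simp: keys_bit_chain_add keys_chain_map2_involution[OF c] K(1) fin)
qed

lemma sym_chain_keys_image: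
  assumes "z \<in> sym_chains q X T"
  shows "simplex_map q T ` Poly_Mapping.keys z = Poly_Mapping.keys z"
  using assms keys_chain_map2_involution[of z q] by (simp add: sym_chains_def)

lemma side_vertex_simplex_map:
  assumes "singular_simplex q X \<sigma>" "i \<le> q"
  shows "side T (simplex_map q T \<sigma> (vertex i)) \<longleftrightarrow> \<not> side T (\<sigma> (vertex i))"
  using side_involution[OF vertex_in_topspace[OF assms]] assms(2) by (simp add: simplex_map_def)

lemma sym_chain_half:
  assumes z: "z \<in> sym_chains q X T"
  obtains c where "c \<in> chains2 q X" "z = c + chain_map2 q T c"
proof -
  let ?K = "{\<sigma> \<in> Poly_Mapping.keys z. side T (\<sigma> (vertex 0))}"
  have ss: "singular_simplex q X \<sigma>" if "\<sigma> \<in> Poly_Mapping.keys z" for \<sigma>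
    using that z by (auto simp: sym_chains_def chains2_def)
  have inv: "simplex_map q T \<sigma> \<in> Poly_Mapping.keys z" if "\<sigma> \<in> Poly_Mapping.keys z" for \<sigma>
    using sym_chain_keys_image[OF z] that by blast
  have "\<sigma> \<in> simplex_map q T ` ?K" if "\<sigma> \<in> Poly_Mapping.keys z" "\<not> side T (\<sigma> (vertex 0))" for \<sigma>
    using that side_vertex_simplex_map[OF ss, of \<sigma> 0]
    by (intro image_eqI[of _ _ "simplex_map q T \<sigma>"]) (simp_all add: inv simplex_map_involution[OF ss])
  then have "Poly_Mapping.keys z = ?K \<union> simplex_map q T ` ?K"
    using inv by auto
  moreover have "?K \<inter> simplex_map q T ` ?K = {}"
    using side_vertex_simplex_map[OF ss, of _ 0] by auto
  ultimately show thesis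
    using sym_chain_split[OF z, of ?K] that by blast
qed

text \<open>A simplex that alternates from either side has exactly one face that alternates from the prescribed
side, any other simplex has an even number, and \<open>T\<close> exchanges the two kinds of
alternation. This identity carries everything that follows: it gives the recursion
\<open>\<nu>(c + T c) = \<nu>(\<partial> c)\<close>, whichever half \<open>c\<close> is taken, and the vanishing on symmetric boundaries.\<close>

lemma alternation_number_boundary:
  assumes "c \<in> chains2 (Suc q) X"
  shows "alternation_number T q (boundary2 (Suc q) c) =
    alternation_number T (Suc q) (c + chain_map2 (Suc q) T c)"
proof -
  have "Poly_Mapping.keys c \<subseteq> singular_simplex_set (Suc q) X"
    using assms by (simp add: chains2_def)
  then show ?thesis
  proof (induction c rule: bit_chain_induct)
    case zero
    show ?case by simp
  next
    case (single \<sigma>)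
    let ?f = "\<lambda>i. side T (\<sigma> (vertex i))"
    have "alternation_number T q (boundary2 (Suc q) (Poly_Mapping.single \<sigma> 1)) =
        (\<Sum>k\<le>Suc q. of_bool (alternating T q (singular_face (Suc q) k \<sigma>)))"
      by (simp only: boundary2_single alternation_number_sum alternation_number_single)
    also have "\<dots> = (\<Sum>k\<le>Suc q. of_bool (\<forall>i\<le>q. ?f (if i < k then i else Suc i) = (False \<noteq> odd i)))"
      by (intro sum.cong refl arg_cong[where f=of_bool])
         (simp add: alternating_def singular_face_vertex del: if_split cong: imp_cong)
    also have "\<dots> = of_bool (\<forall>i\<le>Suc q. ?f i = odd i) + of_bool (\<forall>i\<le>Suc q. ?f i = even i)"
      by (rule alternating_deletions)
    also have "(\<forall>i\<le>Suc q. ?f i = odd i) \<longleftrightarrow> alternating T (Suc q) \<sigma>"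
      by (simp add: alternating_def)
    also have "(\<forall>i\<le>Suc q. ?f i = even i) \<longleftrightarrow> alternating T (Suc q) (simplex_map (Suc q) T \<sigma>)"
      using side_vertex_simplex_map[of "Suc q" \<sigma>] single by (auto simp: alternating_def)
    finally show ?case
      by (simp only: alternation_number_add chain_map2_single alternation_number_single)
  next
    case (add a b)
    then show ?case
      by (simp only: boundary2_add chain_map2_add alternation_number_add ac_simps)
  qed
qed

lemma sym_boundary_alternation_number:
  assumes "c \<in> sym_chains (Suc q) X T"
  shows "alternation_number T q (boundary2 (Suc q) c) = 0"
  using alternation_number_boundary[of c q] assms by (simp add: sym_chains_def)

lemma half_chain_boundary_sym_cycle:
  assumes c: "c \<in> chains2 (Suc q) X" and z: "boundary2 (Suc q) (c + chain_map2 (Suc q) T c) = 0"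
  shows "boundary2 (Suc q) c \<in> sym_cycles q X T"
proof -
  have "chain_map2 q T (boundary2 (Suc q) c) = boundary2 (Suc q) c"
    using z boundary2_chain_map2[OF c, of T] by (simp add: boundary2_add bit_chain_add_eq_0_iff)
  then show ?thesis
    using boundary2_in_chains2[OF c] boundary2_boundary2[OF c]
    by (simp add: sym_cycles_def sym_chains_def)
qed

text \<open>Both sides obey the same recursion, for any choice of the half chain. Thus \<open>yang_nu\<close> is the
restriction of a linear functional that depends neither on a half chain nor on the space.\<close>

lemma yang_nu_eq_alternation_number:
  assumes "z \<in> sym_cycles q X T"
  shows "yang_nu q X T z = alternation_number T q z"
  using assms
proof (induction q arbitrary: z)
  case (0 z)
  define c where "c = half_chain 0 X T z"
  have c: "c \<in> chains2 0 X" "z = c + chain_map2 0 T c"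
    using sym_chain_half[of z 0] 0 someI_ex[of "\<lambda>c. c \<in> chains2 0 X \<and> z = c + chain_map2 0 T c"]
    unfolding c_def half_chain_def sym_cycles_def by blast+
  have "Poly_Mapping.keys c \<subseteq> singular_simplex_set 0 X"
    using c(1) by (simp add: chains2_def)
  then have "(\<Sum>\<sigma>\<in>Poly_Mapping.keys c. 1 :: bit) = alternation_number T 0 (c + chain_map2 0 T c)"
  proof (induction c rule: bit_chain_induct)
    case (single \<sigma>)
    then show ?case
      using side_vertex_simplex_map[of 0 \<sigma> 0] 
      by (cases "side T (\<sigma> (vertex 0))")
         (simp_all add: alternation_number_add alternating_def)
  next
    case (add a b)
    then show ?case
      by (simp only: sum_keys_bit_chain_add bit_add_self alternation_number_add chain_map2_add ac_simps)
  qed simp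
  then show ?case
    unfolding c(2)[symmetric] by (simp add: chain_index2_def lookup_bit_chain c_def)
next
  case (Suc q z)
  define c where "c = half_chain (Suc q) X T z"
  have c: "c \<in> chains2 (Suc q) X" "z = c + chain_map2 (Suc q) T c"
    using sym_chain_half[of z "Suc q"] Suc.prems
      someI_ex[of "\<lambda>c. c \<in> chains2 (Suc q) X \<and> z = c + chain_map2 (Suc q) T c"]
    unfolding c_def half_chain_def sym_cycles_def by blast+
  have "boundary2 (Suc q) (c + chain_map2 (Suc q) T c) = 0"
    using Suc.prems c(2) by (simp add: sym_cycles_def)
  then have "boundary2 (Suc q) c \<in> sym_cycles q X T"
    using c(1) half_chain_boundary_sym_cycle by blast
  then have "yang_nu q X T (boundary2 (Suc q) c) = alternation_number T q (boundary2 (Suc q) c)"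
    by (rule Suc.IH)
  then show ?case
    using alternation_number_boundary[OF c(1)] unfolding c(2)[symmetric] by (simp add: c_def)
qed

lemma subdivision2_sym_cycle:
  assumes "z \<in> sym_cycles q X T"
  shows "subdivision2 q z \<in> sym_cycles q X T"
proof -
  have z: "z \<in> chains2 q X" "chain_map2 q T z = z" "boundary2 q z = 0"
    using assms by (auto simp: sym_cycles_def sym_chains_def)
  have "boundary2 q (subdivision2 q z) = 0"
  proof (cases q)
    case (Suc p)
    then show ?thesis
      using boundary2_subdivision2[of z p X] z by (simp add: subdivision2_def)
  qed simp
  then show ?thesis
    using subdivision2_in_chains2[OF z(1)] subdivision2_chain_map2[OF z(1), of T] z(2)
    by (simp add: sym_cycles_def sym_chains_def)
qed

text \<open>Subdivision commutes with \<open>T\<close> and with the boundary, so the recursion for the alternation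
number reduces the claim to degree zero, where subdivision is the identity.\<close>

lemma subdivision2_alternation_number:
  assumes "z \<in> sym_cycles q X T"
  shows "alternation_number T q (subdivision2 q z) = alternation_number T q z"
  using assms
proof (induction q arbitrary: z)
  case 0
  then show ?case
    by (simp add: subdivision2_zero_dim[of z X] sym_cycles_def sym_chains_def)
next
  case (Suc q)
  obtain c where c: "c \<in> chains2 (Suc q) X" "z = c + chain_map2 (Suc q) T c"
    using sym_chain_half[of z "Suc q"] Suc.prems by (auto simp: sym_cycles_def)
  have y: "boundary2 (Suc q) c \<in> sym_cycles q X T"
    using half_chain_boundary_sym_cycle[OF c(1)] Suc.prems c(2) by (simp add: sym_cycles_def)
  have "alternation_number T (Suc q) (subdivision2 (Suc q) z) =
      alternation_number T (Suc q) (subdivision2 (Suc q) c + chain_map2 (Suc q) T (subdivision2 (Suc q) c))"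
    by (simp only: c(2) subdivision2_add subdivision2_chain_map2[OF c(1)])
  also have "\<dots> = alternation_number T q (boundary2 (Suc q) (subdivision2 (Suc q) c))"
    using alternation_number_boundary[OF subdivision2_in_chains2[OF c(1)]] by simp
  also have "\<dots> = alternation_number T q (subdivision2 q (boundary2 (Suc q) c))"
    by (simp add: boundary2_subdivision2[OF c(1)])
  also have "\<dots> = alternation_number T q (boundary2 (Suc q) c)"
    by (rule Suc.IH[OF y])
  also have "\<dots> = alternation_number T (Suc q) z"
    using alternation_number_boundary[OF c(1)] c(2) by simp
  finally show ?case .
qed

lemma iterated_subdivision2_sym_cycle:
  assumes "z \<in> sym_cycles q X T"
  shows "(subdivision2 q ^^ n) z \<in> sym_cycles q X T \<and>
    alternation_number T q ((subdivision2 q ^^ n) z) = alternation_number T q z"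
  by (induction n) (auto simp: assms subdivision2_sym_cycle subdivision2_alternation_number)

end

section \<open>Cup length and vanishing of the alternation number\<close>

lemma boundary2_in_chains2_subtopology:
  assumes "c \<in> chains2 (Suc q) X" "\<And>\<sigma>. \<sigma> \<in> Poly_Mapping.keys c \<Longrightarrow> \<sigma> ` standard_simplex (Suc q) \<subseteq> U"
  shows "boundary2 (Suc q) c \<in> chains2 q (subtopology X U)"
  using assms by (intro boundary2_in_chains2) (auto simp: chains2_def singular_simplex_subtopology)

lemma chains2_subtopology_image:
  assumes "c \<in> chains2 q (subtopology X U)" "\<sigma> \<in> Poly_Mapping.keys c"
  shows "\<sigma> ` standard_simplex q \<subseteq> U"
proof -
  have "singular_simplex q (subtopology X U) \<sigma>"
    using assms by (auto simp: chains2_def)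
  then show ?thesis
    by (simp add: singular_simplex_subtopology)
qed

context free_involution
begin

text \<open>One step of the cup length argument. The double covering is trivial over \<open>A \<union> B\<close>,
so after subdivision the simplices there can be halved by taking those in \<open>A\<close>. All other simplices lie in
\<open>U\<close>. The boundary of the resulting half chain is a symmetric cycle of one degree less, and it
lies in \<open>U\<close>, where the alternation number vanishes by assumption.\<close>

lemma alternation_vanishes_step:
  assumes U: "openin X U" "T ` U \<subseteq> U"
    and A: "openin X A" "openin X B" "T ` A \<subseteq> B" "T ` B \<subseteq> A" "A \<inter> B = {}"
    and cover: "topspace X \<subseteq> U \<union> A \<union> B"
    and vanish: "\<And>y. y \<in> sym_cycles q (subtopology X U) T \<Longrightarrow> alternation_number T q y = 0"
    and z: "z \<in> sym_cycles (Suc q) X T"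
  shows "alternation_number T (Suc q) z = 0"
proof -
  let ?\<Delta> = "standard_simplex (Suc q)"
  let ?T = "simplex_map (Suc q) T"
  have "z \<in> chains2 (Suc q) X"
    using z by (simp add: sym_cycles_def sym_chains_def)
  moreover have "openin X V" if "V \<in> {U, A, B}" for V
    using that U A by auto
  moreover have "topspace X \<subseteq> \<Union>{U, A, B}"
    using cover by auto
  ultimately obtain n where n: "\<And>\<sigma>. \<sigma> \<in> Poly_Mapping.keys ((subdivision2 (Suc q) ^^ n) z) \<Longrightarrow> \<exists>V\<in>{U, A, B}. \<sigma> ` ?\<Delta> \<subseteq> V"
    using iterated_subdivision2_small[of "{U, A, B}" X z "Suc q"] by metis
  define z' where "z' = (subdivision2 (Suc q) ^^ n) z"
  have z': "z' \<in> sym_cycles (Suc q) X T" "alternation_number T (Suc q) z' = alternation_number T (Suc q) z"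
    using iterated_subdivision2_sym_cycle[OF z, of n] by (auto simp: z'_def)
  have sym: "z' \<in> sym_chains (Suc q) X T" and z'_cycle: "boundary2 (Suc q) z' = 0"
    using z' by (auto simp: sym_cycles_def)
  have ss: "singular_simplex (Suc q) X \<sigma>" if "\<sigma> \<in> Poly_Mapping.keys z'" for \<sigma>
    using that sym by (auto simp: sym_chains_def chains2_def)
  have T_image: "?T \<sigma> ` ?\<Delta> = T ` \<sigma> ` ?\<Delta>" for \<sigma>
    by (auto simp: simplex_map_def image_image)
  have T_keys: "?T \<sigma> \<in> Poly_Mapping.keys z'" if "\<sigma> \<in> Poly_Mapping.keys z'" for \<sigma>
    using sym_chain_keys_image[OF sym] that by blast
  have T_T: "?T (?T \<sigma>) = \<sigma>" if "\<sigma> \<in> Poly_Mapping.keys z'" for \<sigma>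
    using simplex_map_involution[OF ss[OF that]] .
  have \<Delta>_vertex: "vertex 0 \<in> ?\<Delta>"
    by simp
  \<comment> \<open>The half chain consists of the simplices in \<open>A\<close> and one simplex of each orbit in the remainder.\<close>
  define KA where "KA = {\<sigma> \<in> Poly_Mapping.keys z'. \<sigma> ` ?\<Delta> \<subseteq> A}"
  define KB where "KB = {\<sigma> \<in> Poly_Mapping.keys z'. \<sigma> ` ?\<Delta> \<subseteq> B}"
  define R where "R = Poly_Mapping.keys z' - KA - KB"
  define R0 where "R0 = {\<sigma> \<in> R. side T (\<sigma> (vertex 0))}"
  have fin: "finite KA" "finite KB" "finite R0"
    by (auto simp: KA_def KB_def R0_def R_def)
  have T_KA: "?T \<sigma> \<in> KB" if "\<sigma> \<in> KA" for \<sigma>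
    using that A(3) T_keys by (fastforce simp: KA_def KB_def T_image)
  have T_KB: "?T \<sigma> \<in> KA" if "\<sigma> \<in> KB" for \<sigma>
    using that A(4) T_keys by (fastforce simp: KA_def KB_def T_image)
  have AB: "KA \<inter> KB = {}"
    using A(5) \<Delta>_vertex unfolding KA_def KB_def by blast
  have T_R: "?T \<sigma> \<in> R" if "\<sigma> \<in> R" for \<sigma>
    using that T_keys[of \<sigma>] T_KA[of "?T \<sigma>"] T_KB[of "?T \<sigma>"] T_T[of \<sigma>] by (auto simp: R_def)
  have R_U: "\<sigma> ` ?\<Delta> \<subseteq> U" if "\<sigma> \<in> R" for \<sigma>
    using that n[of \<sigma>] by (auto simp: R_def KA_def KB_def z'_def)
  have side_T: "side T (?T \<sigma> (vertex 0)) \<longleftrightarrow> \<not> side T (\<sigma> (vertex 0))" if "\<sigma> \<in> R" for \<sigma>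
    using side_vertex_simplex_map[OF ss, of \<sigma> 0] that by (simp add: R_def)
  let ?K = "KA \<union> R0"
  have "\<sigma> \<in> ?K \<union> ?T ` ?K" if \<sigma>: "\<sigma> \<in> Poly_Mapping.keys z'" for \<sigma>
  proof -
    have "\<sigma> \<in> ?T ` ?K" if "?T \<sigma> \<in> ?K"
      using that T_T[OF \<sigma>] by (metis imageI)
    moreover have "\<sigma> \<in> ?K \<or> ?T \<sigma> \<in> ?K"
      using \<sigma> T_KB[of \<sigma>] T_R[of \<sigma>] side_T[of \<sigma>] by (auto simp: R0_def R_def)
    ultimately show ?thesis by blast
  qed
  moreover have "?K \<subseteq> Poly_Mapping.keys z'"
    by (auto simp: KA_def R0_def R_def)
  ultimately have K1: "Poly_Mapping.keys z' = ?K \<union> ?T ` ?K"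
    using T_keys by blast
  have K2: "?K \<inter> ?T ` ?K = {}"
  proof -
    have "?T \<sigma> \<notin> ?K" if "\<sigma> \<in> KA" for \<sigma>
      using T_KA[OF that] AB by (auto simp: R0_def R_def)
    moreover have "?T \<sigma> \<notin> ?K" if "\<sigma> \<in> R0" for \<sigma>
      using that T_R[of \<sigma>] side_T[of \<sigma>] by (auto simp: R0_def R_def)
    ultimately show ?thesis by blast
  qed
  define c where "c = chain_of_set ?K"
  have c: "c \<in> chains2 (Suc q) X" "z' = c + chain_map2 (Suc q) T c"
    using sym_chain_split[OF sym K1 K2] by (auto simp: c_def)
  define a where "a = chain_of_set KA"
  define b where "b = chain_of_set R0"
  have keys_ab: "Poly_Mapping.keys a = KA" "Poly_Mapping.keys b = R0"
    using fin by (auto simp: a_def b_def)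
  have "KA \<inter> R0 = {}"
    by (auto simp: R0_def R_def)
  then have "Poly_Mapping.keys c = Poly_Mapping.keys (a + b)"
    using fin by (auto simp: c_def keys_bit_chain_add keys_ab)
  then have c_ab: "c = a + b"
    by (rule bit_chain_eqI)
  have ab: "a \<in> chains2 (Suc q) X" "b \<in> chains2 (Suc q) X"
    using ss by (auto simp: chains2_def keys_ab KA_def R0_def R_def)
  have a_A: "boundary2 (Suc q) a \<in> chains2 q (subtopology X A)"
    by (rule boundary2_in_chains2_subtopology[OF ab(1)]) (auto simp: keys_ab KA_def)
  have Ta_B: "boundary2 (Suc q) (chain_map2 (Suc q) T a) \<in> chains2 q (subtopology X B)"
    by (rule boundary2_in_chains2_subtopology[OF chain_map2_involution_in_chains2[OF ab(1)]])
       (use T_KA in \<open>auto simp: keys_chain_map2_involution[OF ab(1)] keys_ab KB_def\<close>)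
  have b_U: "boundary2 (Suc q) b \<in> chains2 q (subtopology X U)"
    by (rule boundary2_in_chains2_subtopology[OF ab(2)]) (use R_U in \<open>auto simp: keys_ab R0_def\<close>)
  have Tb_U: "boundary2 (Suc q) (chain_map2 (Suc q) T b) \<in> chains2 q (subtopology X U)"
    by (rule boundary2_in_chains2_subtopology[OF chain_map2_involution_in_chains2[OF ab(2)]])
       (use T_R R_U in \<open>auto simp: keys_chain_map2_involution[OF ab(2)] keys_ab R0_def\<close>)
  have total: "(boundary2 (Suc q) a + boundary2 (Suc q) (chain_map2 (Suc q) T a)) +
      (boundary2 (Suc q) b + boundary2 (Suc q) (chain_map2 (Suc q) T b)) = 0"
    using z'_cycle unfolding c(2) c_ab by (simp only: boundary2_add chain_map2_add ac_simps)
  \<comment> \<open>A simplex of the boundary of \<open>a\<close> lies in \<open>A\<close> and cannot be cancelled by one in \<open>B\<close>.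
    As the total boundary is zero, it occurs in the boundary of the part over \<open>U\<close>.\<close>
  have "\<sigma> ` standard_simplex q \<subseteq> U" if \<sigma>: "\<sigma> \<in> Poly_Mapping.keys (boundary2 (Suc q) a)" for \<sigma>
  proof -
    have "vertex 0 \<in> standard_simplex q"
      by simp
    moreover have "\<sigma> ` standard_simplex q \<subseteq> A"
      using chains2_subtopology_image[OF a_A \<sigma>] .
    moreover have "\<sigma> ` standard_simplex q \<subseteq> B" if "\<sigma> \<in> Poly_Mapping.keys (boundary2 (Suc q) (chain_map2 (Suc q) T a))"
      using chains2_subtopology_image[OF Ta_B that] .
    ultimately have "\<sigma> \<notin> Poly_Mapping.keys (boundary2 (Suc q) (chain_map2 (Suc q) T a))"
      using A(5) by blast
    then have "\<sigma> \<in> Poly_Mapping.keys (boundary2 (Suc q) b + boundary2 (Suc q) (chain_map2 (Suc q) T b))"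
      using \<sigma> total by (metis bit_chain_add_eq_0_iff keys_bit_chain_add)
    then show ?thesis
      using chains2_subtopology_image[OF chains2_add[OF b_U Tb_U]] by blast
  qed
  then have "boundary2 (Suc q) a \<in> chains2 q (subtopology X U)"
    using boundary2_in_chains2[OF ab(1)] unfolding chains2_def singular_simplex_subtopology by blast
  then have y_U: "boundary2 (Suc q) c \<in> chains2 q (subtopology X U)"
    unfolding c_ab boundary2_add using b_U by (rule chains2_add)
  have "boundary2 (Suc q) c \<in> sym_cycles q X T"
    using half_chain_boundary_sym_cycle[OF c(1)] z'_cycle unfolding c(2)[symmetric] by blast
  with y_U have "boundary2 (Suc q) c \<in> sym_cycles q (subtopology X U) T"
    by (simp add: sym_cycles_def sym_chains_def)
  then have "alternation_number T q (boundary2 (Suc q) c) = 0"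
    by (rule vanish)
  then show ?thesis
    using alternation_number_boundary[OF c(1)] z'(2) unfolding c(2)[symmetric] by simp
qed

end

lemma chains2_empty:
  assumes "topspace X = {}" "c \<in> chains2 q X"
  shows "c = 0"
proof -
  have "Poly_Mapping.keys c = {}"
    using assms(2) singular_simplex_empty[OF assms(1), of q] unfolding chains2_def by blast
  then show ?thesis
    by simp
qed

text \<open>The sets \<open>{f i \<noteq> 0}\<close> cover the space, and \<open>T\<close> exchanges the two parts \<open>{f i > 0}\<close> and
\<open>{f i < 0}\<close> of each. Adding the sets one at a time raises the degree in which the alternation number
vanishes by one each time; on the empty space it vanishes in degree zero.\<close>

lemma alternation_vanishes:
  assumes "free_involution X T"
    and "\<And>i. i < m \<Longrightarrow> continuous_map X euclideanreal (f i)"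
    and "\<And>i x. i < m \<Longrightarrow> x \<in> topspace X \<Longrightarrow> f i (T x) = - f i x"
    and "\<And>x. x \<in> topspace X \<Longrightarrow> \<exists>i<m. f i x \<noteq> 0"
    and "z \<in> sym_cycles m X T"
  shows "alternation_number T m z = 0"
  using assms
proof (induction m arbitrary: X z)
  case 0
  have "topspace X = {}"
    using "0.prems"(4) by blast
  then have "z = 0"
    using chains2_empty[of X z 0] "0.prems"(5) by (simp add: sym_cycles_def sym_chains_def)
  then show ?case
    by simp
next
  case (Suc m)
  interpret free_involution X T
    by (rule Suc.prems(1))
  have cont: "continuous_map X euclideanreal (f i)" if "i \<le> m" for i
    using Suc.prems(2) that by simp
  have odd: "f i (T x) = - f i x" if "i \<le> m" "x \<in> topspace X" for i x
    using Suc.prems(3) that by simp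
  have "openin X {x \<in> topspace X. f i x \<in> - {0}}" if "i < m" for i
    by (rule openin_continuous_map_preimage[OF cont]) (use that in auto)
  then have "openin X (\<Union>i<m. {x \<in> topspace X. f i x \<in> - {0}})"
    by blast
  moreover define U where "U = (\<Union>i<m. {x \<in> topspace X. f i x \<in> - {0}})"
  ultimately have U: "openin X U"
    by simp
  have TU: "T ` U \<subseteq> U"
    using odd involution_in_topspace by (fastforce simp: U_def)
  have "openin X {x \<in> topspace X. f m x \<in> {0<..}}" "openin X {x \<in> topspace X. f m x \<in> {..<0}}"
    by (rule openin_continuous_map_preimage[OF cont]; simp)+
  moreover have "alternation_number T m y = 0" if "y \<in> sym_cycles m (subtopology X U) T" for y
  proof (rule Suc.IH[OF free_involution_subtopology[OF TU] _ _ _ that])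
    show "continuous_map (subtopology X U) euclideanreal (f i)" if "i < m" for i
      using cont[of i] that by (simp add: continuous_map_from_subtopology)
  qed (use odd in \<open>auto simp: U_def\<close>)
  moreover have "topspace X \<subseteq> U \<union> {x \<in> topspace X. f m x \<in> {0<..}} \<union> {x \<in> topspace X. f m x \<in> {..<0}}"
  proof
    fix x assume x: "x \<in> topspace X"
    then obtain i where "i < Suc m" "f i x \<noteq> 0"
      using Suc.prems(4) by blast
    then show "x \<in> U \<union> {x \<in> topspace X. f m x \<in> {0<..}} \<union> {x \<in> topspace X. f m x \<in> {..<0}}"
      using x by (cases "i = m") (auto simp: U_def)
  qed
  ultimately show ?case
    using odd[of m] involution_in_topspace
    by (intro alternation_vanishes_step[OF U TU _ _ _ _ _ _ _ Suc.prems(5), of "{x \<in> topspace X. f m x \<in> {0<..}}" "{x \<in> topspace X. f m x \<in> {..<0}}"])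
       auto
qed

section \<open>Octahedral cycles\<close>

text \<open>The face of the cross-polytope with vertices \<open>e\<^sub>i\<close> for \<open>i \<in> \<epsilon>\<close> and \<open>- e\<^sub>i\<close> for the other
\<open>i \<le> j\<close>, projected radially to the unit sphere.\<close>

definition octahedral_simplex :: "nat \<Rightarrow> nat set \<Rightarrow> (nat \<Rightarrow> real) \<Rightarrow> nat \<Rightarrow> real" where
  "octahedral_simplex j \<epsilon> t = (\<lambda>i. if i \<le> j then (if i \<in> \<epsilon> then t i else - t i) / sqrt (\<Sum>i\<le>j. (t i)\<^sup>2) else 0)"

lemma standard_simplex_norm_pos:
  assumes "t \<in> standard_simplex j"
  shows "(\<Sum>i\<le>j. (t i)\<^sup>2) > 0"
proof -
  have "(\<Sum>i\<le>j. t i) = 1"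
    using assms by (simp add: standard_simplex_def)
  then obtain i where "i \<le> j" "t i \<noteq> 0"
    by (metis atMost_iff sum.neutral zero_neq_one)
  then show ?thesis
    by (intro sum_pos2[of _ i]) auto
qed

lemma octahedral_simplex_continuous:
  assumes "j \<le> n"
  shows "continuous_map (subtopology (powertop_real UNIV) (standard_simplex j)) (nsphere n) (octahedral_simplex j \<epsilon>)"
proof -
  have "continuous_on (standard_simplex j) (\<lambda>t. octahedral_simplex j \<epsilon> t i)" for i
  proof (cases "i \<le> j")
    case True
    have proj: "continuous_on (standard_simplex j) (\<lambda>t. t k)" for k
      by (rule continuous_on_subset[OF continuous_on_product_coordinates]) simp
    have "sqrt (\<Sum>i\<le>j. (t i)\<^sup>2) \<noteq> 0" if "t \<in> standard_simplex j" for t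
      using standard_simplex_norm_pos[OF that] by simp
    with True show ?thesis
      unfolding octahedral_simplex_def
      by (cases "i \<in> \<epsilon>") (simp_all, (intro continuous_intros proj; simp)+)
  qed (simp add: octahedral_simplex_def)
  then have "continuous_map (top_of_set (standard_simplex j)) euclidean (octahedral_simplex j \<epsilon>)"
    using continuous_on_coordinatewise_then_product by (auto simp: continuous_map_iff_continuous)
  moreover have "(\<Sum>i\<le>n. (octahedral_simplex j \<epsilon> t i)\<^sup>2) = 1" if t: "t \<in> standard_simplex j" for t
  proof -
    have "(\<Sum>i\<le>n. (octahedral_simplex j \<epsilon> t i)\<^sup>2) = (\<Sum>i\<le>j. (octahedral_simplex j \<epsilon> t i)\<^sup>2)"
      using assms by (intro sum.mono_neutral_right) (auto simp: octahedral_simplex_def)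
    also have "\<dots> = (\<Sum>i\<le>j. (t i)\<^sup>2 / (\<Sum>i\<le>j. (t i)\<^sup>2))"
      using standard_simplex_norm_pos[OF t]
      by (intro sum.cong) (auto simp: octahedral_simplex_def power_divide)
    also have "\<dots> = 1"
      using standard_simplex_norm_pos[OF t] by (simp flip: sum_divide_distrib)
    finally show ?thesis .
  qed
  moreover have "octahedral_simplex j \<epsilon> t i = 0" if "i > n" for t i
    using assms that by (simp add: octahedral_simplex_def)
  ultimately show ?thesis
    unfolding nsphere by (auto simp: continuous_map_in_subtopology euclidean_product_topology)
qed

lemma octahedral_simplex_face:
  assumes "k \<le> Suc q"
  shows "octahedral_simplex (Suc q) (insert k \<epsilon>) (simplical_face k t) = octahedral_simplex (Suc q) (\<epsilon> - {k}) (simplical_face k t)"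
  by (auto simp: octahedral_simplex_def simplical_face_def)

lemma octahedral_simplex_compl:
  "octahedral_simplex j ({..j} - \<epsilon>) t = (\<lambda>i. - octahedral_simplex j \<epsilon> t i)"
  by (auto simp: octahedral_simplex_def)

lemma octahedral_simplex_vertex:
  assumes "i \<le> j"
  shows "octahedral_simplex j \<epsilon> (vertex i) = (if i \<in> \<epsilon> then vertex i else (\<lambda>k. - vertex i k))"
proof -
  have "(\<Sum>k\<le>j. (vertex i k)\<^sup>2) = (\<Sum>k\<le>j. vertex i k)"
    by (rule sum.cong) auto
  also have "\<dots> = 1"
    using assms by simp
  finally show ?thesis
    using assms by (auto simp: octahedral_simplex_def)
qed

lemma sum_Pow_cancel:
  fixes f :: "'b set \<Rightarrow> 'k \<Rightarrow>\<^sub>0 bit"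
  assumes "finite A" "k \<in> A" "\<And>\<epsilon>. f (insert k \<epsilon>) = f (\<epsilon> - {k})"
  shows "(\<Sum>\<epsilon>\<in>Pow A. f \<epsilon>) = 0"
proof -
  let ?B = "Pow (A - {k})"
  have "A = insert k (A - {k})"
    using assms(2) by blast
  then have "Pow A = ?B \<union> insert k ` ?B"
    by (metis Pow_insert)
  moreover have "?B \<inter> insert k ` ?B = {}"
    by auto
  moreover have "inj_on (insert k) ?B"
    by (rule inj_onI) (metis Diff_insert_absorb DiffD2 PowD insertI1 subsetD)
  ultimately have "(\<Sum>\<epsilon>\<in>Pow A. f \<epsilon>) = (\<Sum>\<epsilon>\<in>?B. f \<epsilon>) + (\<Sum>\<epsilon>\<in>?B. f (insert k \<epsilon>))"
    using assms(1) by (simp add: sum.union_disjoint sum.reindex)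
  also have "(\<Sum>\<epsilon>\<in>?B. f (insert k \<epsilon>)) = (\<Sum>\<epsilon>\<in>?B. f \<epsilon>)"
    unfolding assms(3) by (rule sum.cong) (auto intro!: arg_cong[where f=f])
  finally show ?thesis
    by simp
qed

context free_involution
begin

text \<open>The sum of the images of all top-dimensional faces of the cross-polytope. A face of codimension
one lies in exactly two of them, which differ in the sign of the deleted vertex, so the sum is a cycle.
The antipodal map permutes the faces, so the cycle is symmetric. At each vertex one sign leads to the
required side, so exactly one face is alternating.\<close>

lemma octahedral_cycle:
  assumes g: "continuous_map (nsphere n) X g"
    and odd: "\<And>x. x \<in> topspace (nsphere n) \<Longrightarrow> g (\<lambda>i. - x i) = T (g x)"
    and j: "j \<le> n"
  obtains z where "z \<in> sym_cycles j X T" "alternation_number T j z = 1"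
proof -
  define \<sigma> where "\<sigma> \<epsilon> = restrict (g \<circ> octahedral_simplex j \<epsilon>) (standard_simplex j)" for \<epsilon>
  have o: "continuous_map (subtopology (powertop_real UNIV) (standard_simplex j)) (nsphere n) (octahedral_simplex j \<epsilon>)" for \<epsilon>
    by (rule octahedral_simplex_continuous[OF j])
  have ss: "singular_simplex j X (\<sigma> \<epsilon>)" for \<epsilon>
    unfolding singular_simplex_def \<sigma>_def using continuous_map_compose[OF o g] by simp
  define z where "z = (\<Sum>\<epsilon>\<in>Pow {..j}. Poly_Mapping.single (\<sigma> \<epsilon>) (1::bit))"
  have chain: "z \<in> chains2 j X"
    unfolding z_def by (intro chains2_sum chains2_single ss)
  have boundary2_sum: "boundary2 q (\<Sum>\<epsilon>\<in>I. c \<epsilon>) = (\<Sum>\<epsilon>\<in>I. boundary2 q (c \<epsilon>))" for q I and c :: "nat set \<Rightarrow> 'a chain2"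
    by (induction I rule: infinite_finite_induct) (simp_all add: boundary2_add)
  have chain_map2_sum: "chain_map2 q f (\<Sum>\<epsilon>\<in>I. c \<epsilon>) = (\<Sum>\<epsilon>\<in>I. chain_map2 q f (c \<epsilon>))" for q f I and c :: "nat set \<Rightarrow> 'a chain2"
    by (induction I rule: infinite_finite_induct) (simp_all add: chain_map2_add)
  have "boundary2 j z = 0"
  proof (cases j)
    case (Suc q)
    have face: "singular_face j k (\<sigma> (insert k \<epsilon>)) = singular_face j k (\<sigma> (\<epsilon> - {k}))" if "k \<le> j" for k \<epsilon>
      using octahedral_simplex_face[of k q] that simplical_face_in_standard_simplex[of j k]
      by (intro ext) (simp add: Suc singular_face_def \<sigma>_def restrict_def)
    have "boundary2 j z = (\<Sum>\<epsilon>\<in>Pow {..j}. \<Sum>k\<le>j. Poly_Mapping.single (singular_face j k (\<sigma> \<epsilon>)) 1)"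
      unfolding z_def boundary2_sum Suc boundary2_single ..
    also have "\<dots> = (\<Sum>k\<le>j. \<Sum>\<epsilon>\<in>Pow {..j}. Poly_Mapping.single (singular_face j k (\<sigma> \<epsilon>)) 1)"
      by (rule sum.swap)
    also have "\<dots> = 0"
      by (intro sum.neutral ballI sum_Pow_cancel) (auto simp: face)
    finally show ?thesis .
  qed simp
  moreover have "chain_map2 j T z = z"
  proof -
    have "simplex_map j T (\<sigma> \<epsilon>) = \<sigma> ({..j} - \<epsilon>)" for \<epsilon>
    proof
      fix t
      show "simplex_map j T (\<sigma> \<epsilon>) t = \<sigma> ({..j} - \<epsilon>) t"
      proof (cases "t \<in> standard_simplex j")
        case True
        then have "octahedral_simplex j \<epsilon> t \<in> topspace (nsphere n)"
          using o[of \<epsilon>] by (auto simp: continuous_map_def)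
        with True show ?thesis
          by (simp add: simplex_map_def \<sigma>_def octahedral_simplex_compl odd)
      qed (simp add: simplex_map_def \<sigma>_def)
    qed
    then have "chain_map2 j T z = (\<Sum>\<epsilon>\<in>Pow {..j}. Poly_Mapping.single (\<sigma> ({..j} - \<epsilon>)) 1)"
      unfolding z_def chain_map2_sum by simp
    also have "\<dots> = z"
      unfolding z_def
      by (rule sum.reindex_bij_witness[of _ "\<lambda>\<epsilon>. {..j} - \<epsilon>" "\<lambda>\<epsilon>. {..j} - \<epsilon>"]) (auto simp: double_diff)
    finally show ?thesis .
  qed
  ultimately have "z \<in> sym_cycles j X T"
    using chain by (simp add: sym_cycles_def sym_chains_def)
  moreover have "alternation_number T j z = 1"
  proof -
    define \<epsilon>0 where "\<epsilon>0 = {i. i \<le> j \<and> side T (g (vertex i)) = odd i}"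
    have side: "side T (\<sigma> \<epsilon> (vertex i)) \<longleftrightarrow> (side T (g (vertex i)) = (i \<in> \<epsilon>))" if "i \<le> j" for i \<epsilon>
    proof -
      have "octahedral_simplex j UNIV (vertex i) \<in> topspace (nsphere n)"
        using o[of UNIV] that by (auto simp: continuous_map_def Pi_iff)
      then have v: "vertex i \<in> topspace (nsphere n)"
        using that by (simp add: octahedral_simplex_vertex)
      then have "g (vertex i) \<in> topspace X"
        using g by (auto simp: continuous_map_def)
      then show ?thesis
        using that side_involution odd[OF v] by (simp add: \<sigma>_def octahedral_simplex_vertex)
    qed
    have "alternating T j (\<sigma> \<epsilon>) \<longleftrightarrow> \<epsilon> = \<epsilon>0" if "\<epsilon> \<in> Pow {..j}" for \<epsilon>
      using that side[of _ \<epsilon>] by (auto simp: alternating_def \<epsilon>0_def)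
    then have "alternation_number T j z = (\<Sum>\<epsilon>\<in>Pow {..j}. of_bool (\<epsilon> = \<epsilon>0))"
      unfolding z_def alternation_number_sum by (intro sum.cong) simp_all
    also have "\<dots> = (\<Sum>\<epsilon>\<in>Pow {..j}. if \<epsilon> = \<epsilon>0 then 1 else 0)"
      by (intro sum.cong) auto
    also have "\<dots> = 1"
      by (subst sum.delta) (auto simp: \<epsilon>0_def)
    finally show ?thesis .
  qed
  ultimately show thesis
    using that by blast
qed

end

section \<open>Comparison of the indices\<close>

context free_involution
begin

lemma yang_nu_star_eq_alternation_number:
  assumes z: "z \<in> sym_cycles q X T"
  shows "yang_nu_star q X T ({(z, z'). z \<in> sym_cycles q X T \<and> z' \<in> sym_cycles q X T \<and>
    z - z' \<in> sym_boundaries q X T} `` {z}) = alternation_number T q z"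
proof -
  let ?h = "{(z, z'). z \<in> sym_cycles q X T \<and> z' \<in> sym_cycles q X T \<and> z - z' \<in> sym_boundaries q X T} `` {z}"
  have const: "yang_nu q X T z' = alternation_number T q z" if "z' \<in> ?h" for z'
  proof -
    have z': "z' \<in> sym_cycles q X T" and "z - z' \<in> sym_boundaries q X T"
      using that by auto
    then obtain c where c: "c \<in> sym_chains (Suc q) X T" "z - z' = boundary2 (Suc q) c"
      by (auto simp: sym_boundaries_def)
    have "alternation_number T q (z' + boundary2 (Suc q) c) = alternation_number T q z'"
      by (simp add: alternation_number_add sym_boundary_alternation_number[OF c(1)])
    moreover have "z = z' + boundary2 (Suc q) c"
      using c(2) by (simp add: algebra_simps)
    ultimately show ?thesis
      using yang_nu_eq_alternation_number[OF z'] by simp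
  qed
  have "0 \<in> sym_boundaries q X T"
    unfolding sym_boundaries_def by (rule image_eqI[of _ _ 0]) (simp_all add: sym_chains_def)
  then have mem: "z \<in> ?h"
    using z by simp
  have "yang_nu q X T ` ?h = (\<lambda>_. alternation_number T q z) ` ?h"
    by (rule image_cong[OF refl const])
  also have "\<dots> = {alternation_number T q z}"
    using mem by (rule image_constant)
  finally show ?thesis
    by (simp add: yang_nu_star_def)
qed

lemma yang_nu_star_image:
  "yang_nu_star q X T ` sym_homology q X T = alternation_number T q ` sym_cycles q X T"
  unfolding sym_homology_def quotient_def UNION_singleton_eq_range image_image
  by (rule image_cong[OF refl yang_nu_star_eq_alternation_number])

lemma yang_nu_star_image_eq_0_iff:
  "yang_nu_star q X T ` sym_homology q X T = {0} \<longleftrightarrow> (\<forall>z\<in>sym_cycles q X T. alternation_number T q z = 0)"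
proof -
  have "0 \<in> sym_cycles q X T"
    by (simp add: sym_cycles_def sym_chains_def)
  then show ?thesis
    unfolding yang_nu_star_image by auto
qed

end

lemma free_involution_uminus:
  fixes S :: "'a::real_normed_vector set"
  assumes "0 \<notin> S" "uminus ` S = S"
  shows "free_involution (top_of_set S) uminus"
proof
  show "continuous_map (top_of_set S) (top_of_set S) uminus"
    using assms(2) by (auto simp: continuous_map_in_subtopology intro!: continuous_intros)
  fix x assume "x \<in> topspace (top_of_set S)"
  then have "x \<noteq> 0"
    using assms(1) by auto
  moreover have "x + x = 2 *\<^sub>R x"
    by (simp add: scaleR_2)
  ultimately have "x + x \<noteq> 0"
    by simp
  then show "- x \<noteq> x"
    by (simp only: neg_eq_iff_add_eq_0 not_False_eq_True)
qed simp

text \<open>The components of an odd map into the punctured space of dimension \<open>m\<close> are \<open>m\<close> odd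
functions without a common zero, so the functional \<open>\<nu>\<close> vanishes in degree \<open>m\<close>.\<close>

lemma yang_index_le_genus:
  fixes S :: "'a::real_normed_vector set"
  assumes "0 \<notin> S" "uminus ` S = S"
  shows "yang_index S \<le> genus S"
  unfolding genus_def
proof (rule INF_greatest)
  interpret free_involution "top_of_set S" uminus
    using assms by (rule free_involution_uminus)
  fix m assume "m \<in> {m. m \<ge> 1 \<and>
     (\<exists>f. continuous_map (top_of_set S) (subtopology (Euclidean_space m) (- {\<lambda>i. 0})) f \<and>
          (\<forall>x\<in>S. f (- x) = (\<lambda>i. - f x i)))}"
  then obtain f where f: "continuous_map (top_of_set S) (subtopology (Euclidean_space m) (- {\<lambda>i. 0})) f"
      and odd: "\<And>x. x \<in> S \<Longrightarrow> f (- x) = (\<lambda>i. - f x i)"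
    by blast
  have "continuous_map (top_of_set S) euclideanreal (\<lambda>x. f x i)" for i
    using f by (auto simp: continuous_map_in_subtopology Euclidean_space_def continuous_map_componentwise_UNIV)
  moreover have "\<exists>i<m. f x i \<noteq> 0" if "x \<in> S" for x
  proof -
    have "f x \<in> topspace (subtopology (Euclidean_space m) (- {\<lambda>i. 0}))"
      using f that by (auto simp: continuous_map_def)
    then have "f x \<noteq> (\<lambda>i. 0)" "\<forall>i\<ge>m. f x i = 0"
      by (auto simp: topspace_Euclidean_space)
    then show ?thesis
      by (metis ext linorder_not_le)
  qed
  ultimately have "\<forall>z\<in>sym_cycles m (top_of_set S) uminus. alternation_number uminus m z = 0"
    using alternation_vanishes[OF free_involution_axioms, of m "\<lambda>i x. f x i"] odd by simp
  then have "yang_nu_star m (top_of_set S) uminus ` sym_homology m (top_of_set S) uminus = {0}"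
    by (simp only: yang_nu_star_image_eq_0_iff)
  then show "yang_index S \<le> enat m"
    unfolding yang_index_def by (intro INF_lower) simp
qed

text \<open>An odd map from the sphere of dimension \<open>k - 1\<close> carries octahedral cycles of every
degree below \<open>k\<close> into \<open>S\<close>, and \<open>\<nu>\<close> does not vanish on them.\<close>

lemma conner_floyd_index_le_yang_index:
  fixes S :: "'a::real_normed_vector set"
  assumes "0 \<notin> S" "uminus ` S = S"
  shows "conner_floyd_index S \<le> yang_index S"
  unfolding conner_floyd_index_def
proof (rule SUP_least)
  interpret free_involution "top_of_set S" uminus
    using assms by (rule free_involution_uminus)
  fix k assume k: "k \<in> {k. k \<ge> 1 \<and>
     (\<exists>g. continuous_map (nsphere (k - 1)) (top_of_set S) g \<and>
          (\<forall>x\<in>topspace (nsphere (k - 1)). g (\<lambda>i. - x i) = - g x))}"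
  then obtain g where g: "continuous_map (nsphere (k - 1)) (top_of_set S) g"
      and odd: "\<And>x. x \<in> topspace (nsphere (k - 1)) \<Longrightarrow> g (\<lambda>i. - x i) = - g x"
    by blast
  show "enat k \<le> yang_index S"
    unfolding yang_index_def
  proof (rule INF_greatest)
    fix j assume "j \<in> {j. yang_nu_star j (top_of_set S) uminus ` sym_homology j (top_of_set S) uminus = {0}}"
    then have vanish: "\<forall>z\<in>sym_cycles j (top_of_set S) uminus. alternation_number uminus j z = 0"
      by (simp only: mem_Collect_eq yang_nu_star_image_eq_0_iff)
    have "\<not> j \<le> k - 1"
    proof
      assume "j \<le> k - 1"
      then obtain z where "z \<in> sym_cycles j (top_of_set S) uminus" "alternation_number uminus j z = 1"
        using octahedral_cycle[OF g odd] by blast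
      then show False
        using vanish by simp
    qed
    then show "enat k \<le> enat j"
      by simp
  qed
qed

section \<open>Total variation and Cheeger sets\<close>

definition indicator_vec :: "'n set \<Rightarrow> real ^ 'n::finite" where
  "indicator_vec A = (\<chi> v. of_bool (v \<in> A))"

definition weighted_norm :: "('n::finite \<Rightarrow> real) \<Rightarrow> real ^ 'n \<Rightarrow> real" where
  "weighted_norm \<mu> x = (\<Sum>v\<in>UNIV. \<mu> v * \<bar>x $ v\<bar>)"

text \<open>The total variation of the indicator vector of \<open>A\<close> is the weight of the edges that leave
\<open>A\<close>, and its norm is the vertex weight of \<open>A\<close>. So \<open>h\<close> bounds the Cheeger ratio of \<open>A\<close>.\<close>

definition cheeger_set :: "'n::finite set set \<Rightarrow> ('n \<Rightarrow> real) \<Rightarrow> ('n set \<Rightarrow> real) \<Rightarrow> real \<Rightarrow> 'n set \<Rightarrow> bool" where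
  "cheeger_set E \<mu> w h A \<longleftrightarrow> A \<noteq> {} \<and>
    total_variation E w (indicator_vec A) \<le> h * weighted_norm \<mu> (indicator_vec A)"

definition cheeger_packing :: "'n::finite set set \<Rightarrow> ('n \<Rightarrow> real) \<Rightarrow> ('n set \<Rightarrow> real) \<Rightarrow> real \<Rightarrow> 'n set set \<Rightarrow> bool" where
  "cheeger_packing E \<mu> w h \<D> \<longleftrightarrow> pairwise disjnt \<D> \<and> (\<forall>A\<in>\<D>. cheeger_set E \<mu> w h A)"

text \<open>Connectedness of the induced subgraph, expressed by cuts because it is used through the fact that the
total variation is additive across a cut without edges.\<close>

definition linked :: "'v set set \<Rightarrow> 'v set \<Rightarrow> bool" where
  "linked E A \<longleftrightarrow> (\<forall>B. B \<subseteq> A \<longrightarrow> B \<noteq> {} \<longrightarrow> A - B \<noteq> {} \<longrightarrow> (\<exists>u\<in>B. \<exists>v\<in>A - B. {u, v} \<in> E))"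

lemma indicator_vec_nth [simp]: "indicator_vec A $ v = of_bool (v \<in> A)"
  by (simp add: indicator_vec_def)

lemma total_variation_eq_sum:
  "total_variation E w x = (\<Sum>e\<in>{(u, v). {u, v} \<in> E}. w {fst e, snd e} * \<bar>x $ fst e - x $ snd e\<bar>) / 2"
  by (simp add: total_variation_def case_prod_beta)

lemma total_variation_additive:
  assumes "\<And>u v. {u, v} \<in> E \<Longrightarrow> \<bar>x $ u - x $ v\<bar> = \<bar>y $ u - y $ v\<bar> + \<bar>z $ u - z $ v\<bar>"
  shows "total_variation E w x = total_variation E w y + total_variation E w z"
proof -
  have "(\<Sum>e\<in>{(u, v). {u, v} \<in> E}. w {fst e, snd e} * \<bar>x $ fst e - x $ snd e\<bar>) =
    (\<Sum>e\<in>{(u, v). {u, v} \<in> E}. w {fst e, snd e} * \<bar>y $ fst e - y $ snd e\<bar> + w {fst e, snd e} * \<bar>z $ fst e - z $ snd e\<bar>)"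
    by (rule sum.cong) (auto simp: assms distrib_left)
  then show ?thesis
    by (simp add: total_variation_eq_sum sum.distrib add_divide_distrib)
qed

lemma total_variation_scaleR: "total_variation E w (c *\<^sub>R x) = \<bar>c\<bar> * total_variation E w x"
  by (simp add: total_variation_eq_sum sum_distrib_left abs_mult mult_ac flip: right_diff_distrib)

lemma total_variation_0 [simp]: "total_variation E w 0 = 0"
  by (simp add: total_variation_eq_sum)

lemma weighted_norm_additive:
  assumes "\<And>v. \<bar>x $ v\<bar> = \<bar>y $ v\<bar> + \<bar>z $ v\<bar>"
  shows "weighted_norm \<mu> x = weighted_norm \<mu> y + weighted_norm \<mu> z"
  by (simp add: weighted_norm_def assms distrib_left sum.distrib)

lemma weighted_norm_scaleR: "weighted_norm \<mu> (c *\<^sub>R x) = \<bar>c\<bar> * weighted_norm \<mu> x"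
  by (simp add: weighted_norm_def sum_distrib_left abs_mult mult_ac)

lemma weighted_norm_0 [simp]: "weighted_norm \<mu> 0 = 0"
  by (simp add: weighted_norm_def)

lemma Phi1_eq: "Phi1 E \<mu> w x = total_variation E w x / weighted_norm \<mu> x"
  by (simp add: Phi1_def weighted_norm_def)

context weighted_graph
begin

lemma edge_neq: "{u, v} \<in> E \<Longrightarrow> u \<noteq> v"
  using edges by (fastforce simp: doubleton_eq_iff)

lemma total_variation_nonneg: "total_variation E w x \<ge> 0"
  unfolding total_variation_eq_sum
  using edge_weight_pos by (intro divide_nonneg_pos sum_nonneg mult_nonneg_nonneg) (auto intro: less_imp_le)

lemma weighted_norm_nonneg: "weighted_norm \<mu> x \<ge> 0"
  unfolding weighted_norm_def
  using vertex_weight_pos by (intro sum_nonneg mult_nonneg_nonneg) (auto intro: less_imp_le)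

lemma weighted_norm_pos:
  assumes "x \<noteq> 0" shows "weighted_norm \<mu> x > 0"
proof -
  obtain v where "x $ v \<noteq> 0"
    using assms by (auto simp: vec_eq_iff)
  then have "0 < \<mu> v * \<bar>x $ v\<bar>"
    using vertex_weight_pos by simp
  then show ?thesis
    unfolding weighted_norm_def
    using vertex_weight_pos by (intro sum_pos2[of _ v]) (auto simp: less_imp_le)
qed

lemma total_variation_add_le:
  "total_variation E w (x + y) \<le> total_variation E w x + total_variation E w y"
proof -
  have "(\<Sum>e\<in>{(u, v). {u, v} \<in> E}. w {fst e, snd e} * \<bar>(x + y) $ fst e - (x + y) $ snd e\<bar>) \<le>
    (\<Sum>e\<in>{(u, v). {u, v} \<in> E}. w {fst e, snd e} * \<bar>x $ fst e - x $ snd e\<bar> + w {fst e, snd e} * \<bar>y $ fst e - y $ snd e\<bar>)"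
    unfolding distrib_left[symmetric]
    using edge_weight_pos by (intro sum_mono mult_left_mono) (auto intro: less_imp_le)
  then show ?thesis
    by (simp add: total_variation_eq_sum sum.distrib flip: add_divide_distrib)
qed

lemma total_variation_sum_le:
  "total_variation E w (\<Sum>i\<in>I. x i) \<le> (\<Sum>i\<in>I. total_variation E w (x i))"
proof (induction I rule: infinite_finite_induct)
  case (insert i I)
  then show ?case
    using total_variation_add_le[of "x i" "\<Sum>i\<in>I. x i"] by simp
qed simp_all

text \<open>The layer-cake decomposition. If \<open>m\<close> is the smallest value of \<open>x\<close> on its support \<open>A\<close>, then
total variation and norm are both additive for \<open>x = m \<cdot> 1\<^bsub>A\<^esub> + y\<close>, and the nonnegative vector
\<open>y\<close> has smaller support. The first summand satisfies the strict inequality because \<open>A\<close> misses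
\<open>P\<close>.\<close>

lemma total_variation_gt_nonneg:
  assumes gt: "\<And>A. A \<noteq> {} \<Longrightarrow> A \<inter> P = {} \<Longrightarrow> \<not> cheeger_set E \<mu> w h A"
    and "\<And>v. x $ v \<ge> 0" "\<And>v. v \<in> P \<Longrightarrow> x $ v = 0" "x \<noteq> 0"
  shows "total_variation E w x > h * weighted_norm \<mu> x"
  using assms(2-)
proof (induction "card {v. x $ v \<noteq> 0}" arbitrary: x rule: less_induct)
  case less
  define A where "A = {v. x $ v \<noteq> 0}"
  have "A \<noteq> {}"
    using less.prems(3) by (auto simp: A_def vec_eq_iff)
  moreover have "A \<inter> P = {}"
    using less.prems(2) by (auto simp: A_def)
  ultimately have gt_A: "total_variation E w (indicator_vec A) > h * weighted_norm \<mu> (indicator_vec A)"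
    using gt[of A] by (simp add: cheeger_set_def)
  define m where "m = Min (($) x ` A)"
  have "m \<in> ($) x ` A"
    unfolding m_def using \<open>A \<noteq> {}\<close> by (intro Min_in) auto
  then obtain a where a: "a \<in> A" "m = x $ a"
    by blast
  have m_le: "m \<le> x $ v" if "v \<in> A" for v
    unfolding m_def using that by (intro Min_le) auto
  have m: "m > 0"
    using a less.prems(1)[of a] by (simp add: A_def)
  define y where "y = x - m *\<^sub>R indicator_vec A"
  have y: "y $ v = (if v \<in> A then x $ v - m else 0)" for v
    by (auto simp: y_def A_def)
  have x: "x $ v = (if v \<in> A then y $ v + m else 0)" for v
    by (auto simp: y A_def)
  have y_nonneg: "y $ v \<ge> 0" for v
    using m_le by (simp add: y)
  have "\<bar>x $ u - x $ v\<bar> = \<bar>(m *\<^sub>R indicator_vec A) $ u - (m *\<^sub>R indicator_vec A) $ v\<bar> + \<bar>y $ u - y $ v\<bar>" for u v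
    using m y_nonneg[of u] y_nonneg[of v] unfolding x by (auto simp: y)
  then have tv: "total_variation E w x = m * total_variation E w (indicator_vec A) + total_variation E w y"
    using total_variation_additive[of E x "m *\<^sub>R indicator_vec A" y] m by (simp add: total_variation_scaleR)
  have "\<bar>x $ v\<bar> = \<bar>(m *\<^sub>R indicator_vec A) $ v\<bar> + \<bar>y $ v\<bar>" for v
    using m y_nonneg[of v] unfolding x by (auto simp: y)
  then have wn: "weighted_norm \<mu> x = m * weighted_norm \<mu> (indicator_vec A) + weighted_norm \<mu> y"
    using weighted_norm_additive[of x "m *\<^sub>R indicator_vec A" y] m by (simp add: weighted_norm_scaleR)
  have "total_variation E w y \<ge> h * weighted_norm \<mu> y"
  proof (cases "y = 0")
    case False
    have "{v. y $ v \<noteq> 0} \<subset> A"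
      using a by (auto simp: y split: if_splits)
    then have "card {v. y $ v \<noteq> 0} < card {v. x $ v \<noteq> 0}"
      unfolding A_def by (intro psubset_card_mono) auto
    then have "total_variation E w y > h * weighted_norm \<mu> y"
      using less.prems(2) by (intro less.hyps y_nonneg False) (auto simp: y A_def)
    then show ?thesis
      by simp
  qed simp
  moreover have "m * total_variation E w (indicator_vec A) > m * (h * weighted_norm \<mu> (indicator_vec A))"
    using gt_A m by simp
  ultimately show ?case
    unfolding tv wn by (simp add: algebra_simps)
qed

text \<open>Total variation and norm both split over the positive and the negative part of \<open>x\<close>.\<close>

lemma total_variation_gt:
  assumes gt: "\<And>A. A \<noteq> {} \<Longrightarrow> A \<inter> P = {} \<Longrightarrow> \<not> cheeger_set E \<mu> w h A"
    and x: "\<And>v. v \<in> P \<Longrightarrow> x $ v = 0" "x \<noteq> 0"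
  shows "total_variation E w x > h * weighted_norm \<mu> x"
proof -
  define p where "p = (\<chi> v. max (x $ v) 0)"
  define n where "n = (\<chi> v. max (- x $ v) 0)"
  have "total_variation E w x = total_variation E w p + total_variation E w n"
    by (rule total_variation_additive) (auto simp: p_def n_def max_def)
  moreover have "weighted_norm \<mu> x = weighted_norm \<mu> p + weighted_norm \<mu> n"
    by (rule weighted_norm_additive) (auto simp: p_def n_def max_def)
  moreover have "p = 0 \<or> total_variation E w p > h * weighted_norm \<mu> p"
    using total_variation_gt_nonneg[OF gt, of P p] x(1) by (auto simp: p_def)
  moreover have "n = 0 \<or> total_variation E w n > h * weighted_norm \<mu> n"
    using total_variation_gt_nonneg[OF gt, of P n] x(1) by (auto simp: n_def)
  moreover have "x = p - n"
    by (auto simp: p_def n_def vec_eq_iff max_def)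
  ultimately show ?thesis
    using x(2) by (auto simp: distrib_left)
qed

text \<open>If \<open>A\<close> splits into two parts without an edge between them, boundary weight and vertex weight are
sums over the parts. By the mediant inequality one of the parts then has ratio at most \<open>h\<close>.\<close>

lemma minimal_cheeger_set_linked:
  assumes A: "cheeger_set E \<mu> w h A"
    and minimal: "\<And>B. B \<subset> A \<Longrightarrow> \<not> cheeger_set E \<mu> w h B"
  shows "linked E A"
  unfolding linked_def
proof (intro allI impI, rule ccontr)
  fix B assume B: "B \<subseteq> A" "B \<noteq> {}" "A - B \<noteq> {}" and no_edge: "\<not> (\<exists>u\<in>B. \<exists>v\<in>A - B. {u, v} \<in> E)"
  have "total_variation E w (indicator_vec A) =
    total_variation E w (indicator_vec B) + total_variation E w (indicator_vec (A - B))"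
  proof (rule total_variation_additive)
    fix u v assume "{u, v} \<in> E"
    moreover from this have "{v, u} \<in> E"
      by (simp add: insert_commute)
    ultimately have "\<not> (u \<in> B \<and> v \<in> A - B)" "\<not> (v \<in> B \<and> u \<in> A - B)"
      using no_edge by blast+
    then show "\<bar>indicator_vec A $ u - indicator_vec A $ v\<bar> = \<bar>indicator_vec B $ u - indicator_vec B $ v\<bar> +
        \<bar>indicator_vec (A - B) $ u - indicator_vec (A - B) $ v\<bar>"
      using B(1) by (auto simp: subset_iff)
  qed
  moreover have "weighted_norm \<mu> (indicator_vec A) =
    weighted_norm \<mu> (indicator_vec B) + weighted_norm \<mu> (indicator_vec (A - B))"
    using B(1) by (intro weighted_norm_additive) (auto simp: subset_iff)
  moreover have "\<not> cheeger_set E \<mu> w h B" "\<not> cheeger_set E \<mu> w h (A - B)"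
    using B by (auto intro!: minimal)
  ultimately show False
    using A B by (auto simp: cheeger_set_def distrib_left)
qed

end

section \<open>Packings and transversals of subtrees of a forest\<close>

context weighted_forest
begin

text \<open>The first vertex of a longest path in \<open>U\<close> is a leaf: a neighbour outside the path would
prolong the path, and a neighbour on it other than the second vertex would close a cycle.\<close>

lemma leaf_exists:
  assumes "U \<noteq> {}"
  obtains v where "v \<in> U" "\<And>p q. p \<in> U \<Longrightarrow> q \<in> U \<Longrightarrow> {v, p} \<in> E \<Longrightarrow> {v, q} \<in> E \<Longrightarrow> p = q"
proof -
  define path where "path vs \<longleftrightarrow> vs \<noteq> [] \<and> distinct vs \<and> set vs \<subseteq> U \<and>
    (\<forall>i. Suc i < length vs \<longrightarrow> {vs ! i, vs ! Suc i} \<in> E)" for vs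
  obtain u where "u \<in> U"
    using assms by blast
  then have "path [u]"
    by (simp add: path_def)
  moreover have "length vs < Suc (card U)" if "path vs" for vs
    using that distinct_card[of vs] card_mono[of U "set vs"] by (simp add: path_def less_Suc_eq_le)
  ultimately obtain vs where vs: "path vs" and longest: "\<And>us. path us \<Longrightarrow> length us \<le> length vs"
    using ex_has_greatest_nat[of path "[u]" length] by (metis less_imp_le)
  define v where "v = vs ! 0"
  have distinct: "distinct vs" and "vs \<noteq> []" and vs_U: "set vs \<subseteq> U"
    and consecutive: "\<And>i. Suc i < length vs \<Longrightarrow> {vs ! i, vs ! Suc i} \<in> E"
    using vs by (auto simp: path_def)
  have "p = vs ! 1 \<and> length vs > 1" if p: "p \<in> U" "{v, p} \<in> E" for p
  proof -
    have "p \<in> set vs"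
    proof (rule ccontr)
      assume "p \<notin> set vs"
      then have "path (p # vs)"
        using distinct vs_U \<open>vs \<noteq> []\<close> p consecutive
        by (auto simp: path_def v_def nth_Cons insert_commute split: nat.splits)
      then show False
        using longest[of "p # vs"] by simp
    qed
    then obtain j where j: "j < length vs" "p = vs ! j"
      by (metis in_set_conv_nth)
    have "j \<noteq> 0"
      using edge_neq[OF p(2)] j(2) by (metis v_def)
    moreover have "\<not> j \<ge> 2"
    proof
      assume "j \<ge> 2"
      have "{take (Suc j) vs ! i, take (Suc j) vs ! (Suc i mod Suc j)} \<in> E" if "i \<le> j" for i
      proof (cases "i = j")
        case True
        then show ?thesis
          using p(2) j by (simp add: v_def insert_commute)
      next
        case False
        then show ?thesis
          using that j(1) consecutive[of i] by simp
      qed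
      then have "graph_cycle E (take (Suc j) vs)"
        using \<open>j \<ge> 2\<close> j(1) distinct by (simp add: graph_cycle_def less_Suc_eq_le min_absorb2 Suc_le_eq)
      then show False
        using no_cycle by blast
    qed
    ultimately have "j = 1"
      by simp
    then show ?thesis
      using j by simp
  qed
  moreover have "v \<in> U"
    using vs_U \<open>vs \<noteq> []\<close> by (auto simp: v_def)
  ultimately show thesis
    using that by metis
qed

text \<open>Induction on \<open>U\<close> by removing a leaf \<open>v\<close>. If \<open>{v}\<close> is a member, it is disjoint from every member that
avoids \<open>v\<close>, and adding \<open>v\<close> to the transversal takes care of all members that contain it.
Otherwise every member that contains \<open>v\<close> also contains its only neighbour. The sets \<open>A - {v}\<close> are then
still nonempty and connected, and members whose remainders are disjoint are themselves
disjoint, since two that share \<open>v\<close> also share the neighbour.\<close>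

lemma packing_transversal:
  assumes "\<And>A. A \<in> \<F> \<Longrightarrow> A \<noteq> {} \<and> A \<subseteq> U \<and> linked E A"
  shows "\<exists>\<D> P. \<D> \<subseteq> \<F> \<and> pairwise disjnt \<D> \<and> card P \<le> card \<D> \<and> (\<forall>A\<in>\<F>. A \<inter> P \<noteq> {})"
  using assms
proof (induction "card U" arbitrary: U \<F>)
  case 0
  then have "\<F> = {}"
    by fastforce
  then show ?case
    by auto
next
  case (Suc n)
  then have "U \<noteq> {}"
    by auto
  then obtain v where v: "v \<in> U" and leaf: "\<And>p q. p \<in> U \<Longrightarrow> q \<in> U \<Longrightarrow> {v, p} \<in> E \<Longrightarrow> {v, q} \<in> E \<Longrightarrow> p = q"
    using leaf_exists by blast
  have card: "n = card (U - {v})"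
    using Suc.hyps(2) v by simp
  note \<F> = Suc.prems
  show ?case
  proof (cases "{v} \<in> \<F>")
    case True
    let ?\<F> = "{A \<in> \<F>. v \<notin> A}"
    have "\<exists>\<D> P. \<D> \<subseteq> ?\<F> \<and> pairwise disjnt \<D> \<and> card P \<le> card \<D> \<and> (\<forall>A\<in>?\<F>. A \<inter> P \<noteq> {})"
      using \<F> by (intro Suc.hyps(1)[OF card]) blast
    then obtain \<D> P where D: "\<D> \<subseteq> ?\<F>" "pairwise disjnt \<D>" "card P \<le> card \<D>" "\<forall>A\<in>?\<F>. A \<inter> P \<noteq> {}"
      by (elim exE conjE)
    have "{v} \<notin> \<D>"
      using D(1) by auto
    then have "card (insert v P) \<le> card (insert {v} \<D>)"
      using D(3) by (simp add: card_insert_if)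
    moreover have "pairwise disjnt (insert {v} \<D>)"
      using D(1,2) by (auto simp: pairwise_insert disjnt_def)
    ultimately show ?thesis
      using D(1,4) True by (intro exI[of _ "insert {v} \<D>"] exI[of _ "insert v P"] conjI) auto
  next
    case False
    have neighbour: "\<exists>p\<in>A - {v}. {v, p} \<in> E" if "A \<in> \<F>" "v \<in> A" for A
    proof -
      have "A - {v} \<noteq> {}"
        using that False by (auto simp: subset_singleton_iff)
      then show ?thesis
        using \<F>[OF that(1)] that(2) unfolding linked_def by (auto dest: spec[of _ "{v}"])
    qed
    have linked: "linked E (A - {v})" if A: "A \<in> \<F>" for A
      unfolding linked_def
    proof (intro allI impI)
      fix B assume B: "B \<subseteq> A - {v}" "B \<noteq> {}" "A - {v} - B \<noteq> {}"
      have l: "linked E A" and AU: "A \<subseteq> U"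
        using \<F>[OF A] by auto
      have "B \<subseteq> A" "A - B \<noteq> {}"
        using B by auto
      then obtain u x where ux: "u \<in> B" "x \<in> A - B" "{u, x} \<in> E"
        using l B(2) unfolding linked_def by meson
      show "\<exists>u\<in>B. \<exists>x\<in>A - {v} - B. {u, x} \<in> E"
      proof (cases "x = v")
        case True
        \<comment> \<open>The only neighbour \<open>u\<close> of \<open>v\<close> lies in \<open>B\<close>, so an edge that leaves \<open>B\<close> together with \<open>v\<close>
          starts in \<open>B\<close>.\<close>
        have "insert v B \<subseteq> A" "insert v B \<noteq> {}" "A - insert v B \<noteq> {}"
          using B ux True by auto
        then obtain u' x' where ux': "u' \<in> insert v B" "x' \<in> A - insert v B" "{u', x'} \<in> E"
          using l unfolding linked_def by meson
        have "u' \<noteq> v"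
        proof
          assume "u' = v"
          then have "x' = u"
            using leaf[of x' u] ux ux' True AU B(1) by (auto simp: insert_commute)
          then show False
            using ux ux' by simp
        qed
        then show ?thesis
          using ux' by auto
      next
        case False
        then show ?thesis
          using ux by auto
      qed
    qed
    let ?f = "\<lambda>A. A - {v}"
    have "\<exists>\<D> P. \<D> \<subseteq> ?f ` \<F> \<and> pairwise disjnt \<D> \<and> card P \<le> card \<D> \<and> (\<forall>A\<in>?f ` \<F>. A \<inter> P \<noteq> {})"
    proof (rule Suc.hyps(1)[OF card])
      fix B assume "B \<in> ?f ` \<F>"
      then obtain A where A: "A \<in> \<F>" "B = A - {v}"
        by blast
      have "B \<noteq> {}"
        using \<F>[OF A(1)] A False by (auto simp: subset_singleton_iff)
      then show "B \<noteq> {} \<and> B \<subseteq> U - {v} \<and> linked E B"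
        using \<F>[OF A(1)] linked[OF A(1)] A(2) by auto
    qed
    then obtain \<D>' P where D': "\<D>' \<subseteq> ?f ` \<F>" "pairwise disjnt \<D>'" "card P \<le> card \<D>'" "\<forall>A\<in>?f ` \<F>. A \<inter> P \<noteq> {}"
      by (elim exE conjE)
    \<comment> \<open>One preimage is chosen for each member of the smaller packing, which keeps the cardinality.\<close>
    then obtain \<D> where D: "\<D> \<subseteq> \<F>" "inj_on ?f \<D>" "\<D>' = ?f ` \<D>"
      by (meson subset_image_inj)
    have "disjnt A B" if "A \<in> \<D>" "B \<in> \<D>" "A \<noteq> B" for A B
    proof -
      have "?f A \<noteq> ?f B"
        using that D(2) by (metis inj_onD)
      then have disj: "disjnt (?f A) (?f B)"
        using that D'(2) D(3) by (auto simp: pairwise_def)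
      have "\<not> (v \<in> A \<and> v \<in> B)"
      proof
        assume v_AB: "v \<in> A \<and> v \<in> B"
        have AB: "A \<in> \<F>" "B \<in> \<F>"
          using that D(1) by auto
        obtain p where p: "p \<in> A - {v}" "{v, p} \<in> E"
          using neighbour[OF AB(1)] v_AB by blast
        obtain q where q: "q \<in> B - {v}" "{v, q} \<in> E"
          using neighbour[OF AB(2)] v_AB by blast
        have "p = q"
          using p q \<F>[OF AB(1)] \<F>[OF AB(2)] by (intro leaf) auto
        then show False
          using p q disj by (auto simp: disjnt_def)
      qed
      then show ?thesis
        using disj by (auto simp: disjnt_def)
    qed
    then have disjoint: "pairwise disjnt \<D>"
      by (simp add: pairwise_def)
    have card_le: "card P \<le> card \<D>"
      using D'(3) D(2,3) by (simp add: card_image)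
    have hit: "A \<inter> P \<noteq> {}" if "A \<in> \<F>" for A
    proof -
      have "(A - {v}) \<inter> P \<noteq> {}"
        using D'(4) that by simp
      then show ?thesis
        by auto
    qed
    show ?thesis
      by (intro exI[of _ \<D>] exI[of _ P] conjI ballI D(1) disjoint card_le hit)
  qed
qed

lemma cheeger_packing_or_transversal:
  assumes "\<nexists>\<D>. cheeger_packing E \<mu> w h \<D> \<and> card \<D> = k"
  obtains P where "card P < k"
    "\<And>x. x \<noteq> 0 \<Longrightarrow> (\<And>v. v \<in> P \<Longrightarrow> x $ v = 0) \<Longrightarrow> total_variation E w x > h * weighted_norm \<mu> x"
proof -
  define \<F> where "\<F> = {A. cheeger_set E \<mu> w h A \<and> (\<forall>B. B \<subset> A \<longrightarrow> \<not> cheeger_set E \<mu> w h B)}"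
  have \<F>: "A \<noteq> {} \<and> A \<subseteq> UNIV \<and> linked E A" if "A \<in> \<F>" for A
    using that minimal_cheeger_set_linked[of h A] by (auto simp: \<F>_def cheeger_set_def)
  have "\<exists>\<D> P. \<D> \<subseteq> \<F> \<and> pairwise disjnt \<D> \<and> card P \<le> card \<D> \<and> (\<forall>A\<in>\<F>. A \<inter> P \<noteq> {})"
    by (rule packing_transversal[of \<F> UNIV]) (rule \<F>)
  then obtain \<D> P where D: "\<D> \<subseteq> \<F>" "pairwise disjnt \<D>" "card P \<le> card \<D>"
      and P: "\<forall>A\<in>\<F>. A \<inter> P \<noteq> {}"
    by (elim exE conjE)
  have "card \<D> < k"
  proof (rule ccontr)
    assume "\<not> card \<D> < k"
    then obtain \<D>' where "\<D>' \<subseteq> \<D>" "card \<D>' = k"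
      by (meson linorder_not_less obtain_subset_with_card_n)
    moreover from this have "cheeger_packing E \<mu> w h \<D>'"
      using D(1) pairwise_subset[OF D(2)] by (auto simp: cheeger_packing_def \<F>_def)
    ultimately show False
      using assms by blast
  qed
  then have card_P: "card P < k"
    using D(3) by simp
  have gt: "\<not> cheeger_set E \<mu> w h A" if "A \<inter> P = {}" for A
  proof
    assume "cheeger_set E \<mu> w h A"
    then obtain B where "B \<subseteq> A" "B \<in> \<F>"
      using finite_has_minimal2[of "{A. cheeger_set E \<mu> w h A}" A] by (auto simp: \<F>_def)
    then show False
      using P that by blast
  qed
  show thesis
    by (rule that[OF card_P]) (rule total_variation_gt[OF gt])
qed

end

section \<open>Min-max eigenvalues as Cheeger constants\<close>

lemma compact_topspace_nsphere: "compact (topspace (nsphere n))"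
proof -
  let ?S = "{x :: nat \<Rightarrow> real. (\<Sum>i\<le>n. (x i)\<^sup>2) = 1 \<and> (\<forall>i>n. x i = 0)}"
  have S: "?S = {x. (\<Sum>i\<le>n. (x i)\<^sup>2) = 1} \<inter> (\<Inter>i\<in>{n<..}. {x. x i = 0})"
    by auto
  have closed: "closed ?S"
    unfolding S by (intro closed_Int closed_INT ballI closed_Collect_eq continuous_intros continuous_on_product_coordinates)
  have "x i \<in> {-1..1}" if "x \<in> ?S" for x i
  proof (cases "i \<le> n")
    case True
    then have "(x i)\<^sup>2 \<le> (\<Sum>i\<le>n. (x i)\<^sup>2)"
      by (intro member_le_sum) auto
    then have "\<bar>x i\<bar> \<le> 1"
      using that by (simp add: abs_square_le_1)
    then show ?thesis
      by (simp add: abs_le_iff)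
  qed (use that in auto)
  then have "?S \<subseteq> UNIV \<rightarrow>\<^sub>E {-1..1}"
    by auto
  then have Int: "?S \<inter> (UNIV \<rightarrow>\<^sub>E {-1..1}) = ?S"
    by (rule Int_absorb2)
  have "compactin (powertop_real UNIV) (UNIV \<rightarrow>\<^sub>E {-1..1} :: (nat \<Rightarrow> real) set)"
    by (simp add: compactin_PiE)
  then have "compact (UNIV \<rightarrow>\<^sub>E {-1..1} :: (nat \<Rightarrow> real) set)"
    by (simp add: euclidean_product_topology)
  from closed_Int_compact[OF closed this] have "compact ?S"
    unfolding Int .
  then show ?thesis
    by (simp add: nsphere)
qed

definition admissible :: "('a::real_normed_vector set \<Rightarrow> enat) \<Rightarrow> nat \<Rightarrow> 'a set \<Rightarrow> bool" where
  "admissible ind k S \<longleftrightarrow> S \<noteq> {} \<and> compact S \<and> 0 \<notin> S \<and> uminus ` S = S \<and> enat k \<le> ind S"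

definition intermediate_index :: "('a::real_normed_vector set \<Rightarrow> enat) \<Rightarrow> bool" where
  "intermediate_index ind \<longleftrightarrow> (\<forall>S. 0 \<notin> S \<longrightarrow> uminus ` S = S \<longrightarrow> conner_floyd_index S \<le> ind S \<and> ind S \<le> genus S)"

lemma intermediate_index_instances: "intermediate_index genus" "intermediate_index conner_floyd_index" "intermediate_index yang_index"
  unfolding intermediate_index_def
  by (auto intro: order_trans[OF conner_floyd_index_le_yang_index yang_index_le_genus]
      conner_floyd_index_le_yang_index yang_index_le_genus)

lemma admissible_sphere_image:
  fixes g :: "(nat \<Rightarrow> real) \<Rightarrow> 'a::real_normed_vector"
  assumes ind: "intermediate_index ind" and k: "k \<ge> 1"
    and g: "continuous_on (topspace (nsphere (k - 1))) g"
    and odd: "\<And>x. g (\<lambda>i. - x i) = - g x"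
    and nonzero: "\<And>x. x \<in> topspace (nsphere (k - 1)) \<Longrightarrow> g x \<noteq> 0"
  shows "admissible ind k (g ` topspace (nsphere (k - 1)))"
proof -
  let ?N = "topspace (nsphere (k - 1))"
  let ?S = "g ` ?N"
  have uminus_N: "(\<lambda>i. - x i) \<in> ?N" if "x \<in> ?N" for x
    using that by (simp add: nsphere)
  have "- g x \<in> ?S" if "x \<in> ?N" for x
    using uminus_N[OF that] by (intro image_eqI[of _ g]) (simp_all add: odd)
  then have "uminus ` ?S \<subseteq> ?S"
    by blast
  then have sym: "uminus ` ?S = ?S"
    using image_mono[of "uminus ` ?S" ?S uminus] by (intro equalityI) (simp_all add: image_image)
  have zero: "0 \<notin> ?S"
    using nonzero by force
  have "continuous_map (nsphere (k - 1)) (top_of_set ?S) g"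
    using g by (auto simp: continuous_map_in_subtopology nsphere euclidean_product_topology)
  then have "enat k \<le> conner_floyd_index ?S"
    unfolding conner_floyd_index_def using k odd by (intro SUP_upper) auto
  then have "enat k \<le> ind ?S"
    using ind zero sym unfolding intermediate_index_def by (metis order_trans)
  moreover have "compact ?S"
    using g compact_topspace_nsphere by (rule compact_continuous_image)
  moreover have "?S \<noteq> {}"
    using in_topspace_nsphere[of "k - 1"] by blast
  ultimately show ?thesis
    using zero sym by (simp add: admissible_def)
qed

context weighted_graph
begin

lemma Phi1_le_iff: "x \<noteq> 0 \<Longrightarrow> Phi1 E \<mu> w x \<le> h \<longleftrightarrow> total_variation E w x \<le> h * weighted_norm \<mu> x"
  using weighted_norm_pos[of x] by (simp add: Phi1_eq divide_le_eq)

lemma Phi1_nonneg: "Phi1 E \<mu> w x \<ge> 0"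
  using total_variation_nonneg weighted_norm_nonneg by (simp add: Phi1_eq)

lemma admissible_bdd_above: "admissible ind k S \<Longrightarrow> bdd_above (Phi1 E \<mu> w ` S)"
proof -
  assume S: "admissible ind k S"
  have "continuous_on S (Phi1 E \<mu> w)"
    unfolding Phi1_eq
  proof (rule continuous_on_divide)
    show "continuous_on S (total_variation E w)"
      unfolding total_variation_eq_sum by (auto intro!: continuous_intros continuous_on_component)
    show "continuous_on S (weighted_norm \<mu>)"
      unfolding weighted_norm_def by (auto intro!: continuous_intros continuous_on_component)
    show "\<forall>x\<in>S. weighted_norm \<mu> x \<noteq> 0"
      using S weighted_norm_pos by (metis admissible_def less_irrefl)
  qed
  then have "compact (Phi1 E \<mu> w ` S)"
    using S by (simp add: admissible_def compact_continuous_image)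
  then show ?thesis
    by (simp add: compact_imp_bounded bounded_imp_bdd_above)
qed

text \<open>The span of the indicator vectors of the packing consists of vectors with Rayleigh quotient at most
\<open>h\<close>: the total variation is subadditive, whereas the norm is additive over the disjoint sets.
The admissible set is the image of the unit sphere of coefficients.\<close>

lemma packing_admissible:
  assumes ind: "intermediate_index ind" and k: "k \<ge> 1"
    and \<D>: "cheeger_packing E \<mu> w h \<D>" "card \<D> = k"
  obtains S where "admissible ind k S" "\<And>x. x \<in> S \<Longrightarrow> Phi1 E \<mu> w x \<le> h"
proof -
  obtain A where A: "bij_betw A {0..<k} \<D>"
    using ex_bij_betw_nat_finite[of \<D>] \<D>(2) by auto
  have cheeger: "cheeger_set E \<mu> w h (A i)" if "i < k" for i
    using \<D>(1) A that by (auto simp: cheeger_packing_def bij_betw_def)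
  have unique: "i = j" if "i < k" "j < k" "v \<in> A i" "v \<in> A j" for i j v
  proof (rule ccontr)
    assume "i \<noteq> j"
    then have "A i \<noteq> A j" "A i \<in> \<D>" "A j \<in> \<D>"
      using A that(1,2) by (auto simp: bij_betw_def inj_on_def)
    then have "disjnt (A i) (A j)"
      using \<D>(1) unfolding cheeger_packing_def pairwise_def by blast
    then show False
      using that(3,4) by (auto simp: disjnt_def)
  qed
  define g :: "(nat \<Rightarrow> real) \<Rightarrow> real ^ 'n" where "g t = (\<Sum>i<k. t i *\<^sub>R indicator_vec (A i))" for t
  have g_nth: "g t $ v = (\<Sum>i<k. t i * of_bool (v \<in> A i))" for t v
    by (simp add: g_def)
  have g_on: "g t $ v = t i" if "i < k" "v \<in> A i" for t i v
  proof -
    have "g t $ v = (\<Sum>j<k. if j = i then t j else 0)"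
      unfolding g_nth
    proof (rule sum.cong)
      fix j assume "j \<in> {..<k}"
      then show "t j * of_bool (v \<in> A j) = (if j = i then t j else 0)"
        using that unique[of j i v] by (cases "v \<in> A j") auto
    qed simp
    then show ?thesis
      using that by simp
  qed
  have abs_g: "\<bar>g t $ v\<bar> = (\<Sum>i<k. \<bar>t i\<bar> * of_bool (v \<in> A i))" for t v
  proof (cases "\<exists>i<k. v \<in> A i")
    case True
    then obtain i where i: "i < k" "v \<in> A i"
      by blast
    have "(\<Sum>j<k. \<bar>t j\<bar> * of_bool (v \<in> A j)) = (\<Sum>j<k. if j = i then \<bar>t j\<bar> else 0)"
    proof (rule sum.cong)
      fix j assume "j \<in> {..<k}"
      then show "\<bar>t j\<bar> * of_bool (v \<in> A j) = (if j = i then \<bar>t j\<bar> else 0)"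
        using i unique[of j i v] by (cases "v \<in> A j") auto
    qed simp
    then show ?thesis
      using i g_on by simp
  next
    case False
    then show ?thesis
      by (simp add: g_nth)
  qed
  have norm_g: "weighted_norm \<mu> (g t) = (\<Sum>i<k. \<bar>t i\<bar> * weighted_norm \<mu> (indicator_vec (A i)))" for t
  proof -
    have "weighted_norm \<mu> (g t) = (\<Sum>v\<in>UNIV. \<Sum>i<k. \<bar>t i\<bar> * (\<mu> v * \<bar>indicator_vec (A i) $ v\<bar>))"
      unfolding weighted_norm_def abs_g sum_distrib_left by (intro sum.cong) auto
    then show ?thesis
      unfolding weighted_norm_def sum_distrib_left by (simp only: sum.swap[of _ UNIV])
  qed
  have tv_g: "total_variation E w (g t) \<le> h * weighted_norm \<mu> (g t)" for t
  proof -
    have "total_variation E w (g t) \<le> (\<Sum>i<k. \<bar>t i\<bar> * total_variation E w (indicator_vec (A i)))"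
      unfolding g_def using total_variation_sum_le[of "\<lambda>i. t i *\<^sub>R indicator_vec (A i)" "{..<k}"]
      by (simp add: total_variation_scaleR)
    also have "\<dots> \<le> (\<Sum>i<k. \<bar>t i\<bar> * (h * weighted_norm \<mu> (indicator_vec (A i))))"
      using cheeger by (intro sum_mono mult_left_mono) (auto simp: cheeger_set_def)
    also have "\<dots> = h * weighted_norm \<mu> (g t)"
      unfolding norm_g by (simp add: sum_distrib_left mult_ac)
    finally show ?thesis .
  qed
  have nonzero: "g t \<noteq> 0" if t: "t \<in> topspace (nsphere (k - 1))" for t
  proof
    assume "g t = 0"
    have "t i = 0" if i: "i < k" for i
    proof -
      obtain v where "v \<in> A i"
        using cheeger[OF i] by (auto simp: cheeger_set_def)
      then show ?thesis
        using g_on[OF i, of v t] \<open>g t = 0\<close> by simp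
    qed
    then have "(\<Sum>i\<le>k - 1. (t i)\<^sup>2) = 0"
      using k by (intro sum.neutral) auto
    then show False
      using t by (simp add: nsphere)
  qed
  have "continuous_on (topspace (nsphere (k - 1))) g"
    unfolding g_def
    by (intro continuous_intros continuous_on_subset[OF continuous_on_product_coordinates]) auto
  moreover have "g (\<lambda>i. - t i) = - g t" for t
    by (simp add: g_def sum_negf)
  ultimately have "admissible ind k (g ` topspace (nsphere (k - 1)))"
    using ind k nonzero by (intro admissible_sphere_image)
  moreover have "Phi1 E \<mu> w x \<le> h" if "x \<in> g ` topspace (nsphere (k - 1))" for x
    using that nonzero tv_g by (auto simp: Phi1_le_iff)
  ultimately show thesis
    by (rule that)
qed

text \<open>Ensures that admissible sets exist for every \<open>k\<close> up to the number of vertices, so that the infimum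
that defines the eigenvalue is taken over a nonempty set.\<close>

lemma singleton_packing_exists:
  assumes "k \<le> CARD('n)"
  obtains h \<D> where "cheeger_packing E \<mu> w h \<D>" "card \<D> = k"
proof -
  obtain V :: "'n set" where V: "card V = k"
    using assms obtain_subset_with_card_n[of k UNIV] by blast
  define h where "h = Max (range (\<lambda>v. Phi1 E \<mu> w (indicator_vec {v})))"
  have "cheeger_set E \<mu> w h {v}" for v
  proof -
    have "indicator_vec {v} \<noteq> 0"
      by (auto simp: vec_eq_iff)
    moreover have "Phi1 E \<mu> w (indicator_vec {v}) \<le> h"
      unfolding h_def by (rule Max_ge) auto
    ultimately show ?thesis
      by (simp add: cheeger_set_def Phi1_le_iff)
  qed
  then have "cheeger_packing E \<mu> w h ((\<lambda>v. {v}) ` V)"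
    by (auto simp: cheeger_packing_def pairwise_def disjnt_def)
  moreover have "card ((\<lambda>v. {v}) ` V) = k"
    using V by (simp add: card_image)
  ultimately show thesis
    by (rule that)
qed

end

context weighted_forest
begin

text \<open>Without a packing of size \<open>k\<close> there is a transversal \<open>P\<close> with fewer than \<open>k\<close> vertices, and no
vector of \<open>S\<close> vanishes on \<open>P\<close>. The coordinates at \<open>P\<close> then form an odd map that bounds
the genus of \<open>S\<close> by the cardinality of \<open>P\<close>.\<close>

lemma admissible_packing:
  assumes ind: "intermediate_index ind" and k: "k \<ge> 1" and S: "admissible ind k S"
    and h: "\<And>x. x \<in> S \<Longrightarrow> Phi1 E \<mu> w x \<le> h"
  shows "\<exists>\<D>. cheeger_packing E \<mu> w h \<D> \<and> card \<D> = k"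
proof (rule ccontr)
  assume "\<not> ?thesis"
  then obtain P where P: "card P < k"
    "\<And>x. x \<noteq> 0 \<Longrightarrow> (\<And>v. v \<in> P \<Longrightarrow> x $ v = 0) \<Longrightarrow> total_variation E w x > h * weighted_norm \<mu> x"
    using cheeger_packing_or_transversal[of h k] by blast
  have S': "S \<noteq> {}" "0 \<notin> S" "uminus ` S = S" "enat k \<le> ind S"
    using S by (auto simp: admissible_def)
  have visible: "\<exists>v\<in>P. x $ v \<noteq> 0" if "x \<in> S" for x
  proof -
    have "x \<noteq> 0"
      using that S'(2) by blast
    then show ?thesis
      using P(2)[of x] h[OF that] by (fastforce simp: Phi1_le_iff)
  qed
  have fin: "finite P"
    by simp
  obtain p where p: "bij_betw p {0..<card P} P"
    using ex_bij_betw_nat_finite[OF fin] by blast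
  \<comment> \<open>The genus ranges over target dimensions that are at least one.\<close>
  have P_pos: "card P \<ge> 1"
    using S'(1) visible fin by (fastforce simp: Suc_le_eq card_gt_0_iff)
  define f where "f x = (\<lambda>i. if i < card P then x $ p i else 0)" for x :: "real ^ 'a"
  have "continuous_map (top_of_set S) (Euclidean_space (card P)) f"
    unfolding f_def continuous_map_componentwise_Euclidean_space by (auto intro!: continuous_intros continuous_on_component)
  moreover have "f x \<noteq> (\<lambda>i. 0)" if x: "x \<in> S" for x
  proof -
    obtain v where "v \<in> P" "x $ v \<noteq> 0"
      using visible[OF x] by blast
    then obtain i where "i < card P" "x $ p i \<noteq> 0"
      using p by (force simp: bij_betw_def)
    then show ?thesis
      by (auto simp: f_def fun_eq_iff)
  qed
  ultimately have "continuous_map (top_of_set S) (subtopology (Euclidean_space (card P)) (- {\<lambda>i. 0})) f"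
    by (auto simp: continuous_map_in_subtopology)
  moreover have "f (- x) = (\<lambda>i. - f x i)" for x
    by (auto simp: f_def)
  ultimately have "genus S \<le> enat (card P)"
    unfolding genus_def using P_pos by (intro INF_lower) auto
  moreover have "ind S \<le> genus S"
    using ind S' by (simp add: intermediate_index_def)
  ultimately have "enat k \<le> enat (card P)"
    using S'(4) by (metis order_trans)
  then show False
    using P(1) by simp
qed

text \<open>An admissible set for one index yields a packing with the same bound on the ratios, and the packing
yields an admissible set for the other index without increasing the bound.\<close>

lemma minmax_eigenvalue_le:
  assumes ind: "intermediate_index ind" "intermediate_index ind'" and k: "1 \<le> k" "k \<le> CARD('a)"
  shows "minmax_eigenvalue ind (Phi1 E \<mu> w) k \<le> minmax_eigenvalue ind' (Phi1 E \<mu> w) k"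
proof -
  let ?sup = "\<lambda>S. SUP x\<in>S. Phi1 E \<mu> w x"
  have eq: "minmax_eigenvalue i (Phi1 E \<mu> w) k = (INF S\<in>{S. admissible i k S}. ?sup S)" for i
    by (simp add: minmax_eigenvalue_def admissible_def)
  have sup_nonneg: "0 \<le> ?sup S" if S: "admissible ind k S" for S
  proof -
    obtain x where "x \<in> S"
      using S by (auto simp: admissible_def)
    then show ?thesis
      using Phi1_nonneg cSUP_upper[OF _ admissible_bdd_above[OF S]] by (metis order_trans)
  qed
  have bdd: "bdd_below (?sup ` {S. admissible ind k S})"
    using sup_nonneg by (intro bdd_belowI[of _ 0]) auto
  obtain h \<D> where "cheeger_packing E \<mu> w h \<D>" "card \<D> = k"
    using singleton_packing_exists[OF k(2)] by blast
  then obtain S0 where "admissible ind' k S0"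
    using packing_admissible[OF ind(2) k(1)] by blast
  then have "{S. admissible ind' k S} \<noteq> {}"
    by blast
  then show ?thesis
    unfolding eq[of ind']
  proof (rule cINF_greatest)
    fix S assume "S \<in> {S. admissible ind' k S}"
    then have S: "admissible ind' k S"
      by simp
    have "Phi1 E \<mu> w x \<le> ?sup S" if "x \<in> S" for x
      using that admissible_bdd_above[OF S] by (rule cSUP_upper)
    then obtain \<D> where "cheeger_packing E \<mu> w (?sup S) \<D>" "card \<D> = k"
      using admissible_packing[OF ind(2) k(1) S] by blast
    then obtain S' where S': "admissible ind k S'" "\<And>x. x \<in> S' \<Longrightarrow> Phi1 E \<mu> w x \<le> ?sup S"
      using packing_admissible[OF ind(1) k(1)] by blast
    have "?sup S' \<le> ?sup S"
      using S' by (intro cSUP_least) (auto simp: admissible_def)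
    moreover have "(INF S\<in>{S. admissible ind k S}. ?sup S) \<le> ?sup S'"
      using S'(1) by (intro cINF_lower[OF bdd]) simp
    ultimately show "minmax_eigenvalue ind (Phi1 E \<mu> w) k \<le> ?sup S"
      unfolding eq by simp
  qed
qed

end

theorem corollary1:
  fixes E :: "'n::finite set set" and \<mu> :: "'n \<Rightarrow> real" and w :: "'n set \<Rightarrow> real" and k :: nat
  assumes "weighted_forest E \<mu> w"
    and "k \<in> {1..CARD('n)}"
  shows "minmax_eigenvalue genus (Phi1 E \<mu> w) k
           = minmax_eigenvalue conner_floyd_index (Phi1 E \<mu> w) k
       \<and> minmax_eigenvalue conner_floyd_index (Phi1 E \<mu> w) k
           = minmax_eigenvalue yang_index (Phi1 E \<mu> w) k"
proof -
  interpret weighted_forest E \<mu> w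
    by (rule assms(1))
  have "1 \<le> k" "k \<le> CARD('n)"
    using assms(2) by simp_all
  then show ?thesis
    using intermediate_index_instances by (intro conjI antisym minmax_eigenvalue_le)
qed

end
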